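(* Let $\kappa\leq\lambda$ be infinite cardinals with $\kappa$ regular, and assume $\lambda>\mathfrak{c}=2^{\aleph_0}$. The following are equivalent: (1) There is a continuous weak $\lambda$-measure space $(X,\mathfrak{M},\mu)$ for some $X\subseteq{}^{\kappa}\lambda$ of weight $\lambda$ such that $\mu$ takes values in $[0,1]$. (2) For every non-$\lambda$-Lindelöf space $X\subseteq{}^{\kappa}\lambda$ of weight $\lambda$ there is $\mu:\mathscr{P}(X)\to[0,1]$ such that $(X,\mathscr{P}(X),\mu)$ is a continuous weak $\lambda$-measure space. (3) $\lambda$ is measurable (i.e. uncountable and carrying a $\lambda$-complete non-principal ultrafilter).
   Context: **Topology.** ${}^{\kappa}\lambda$ is the set of sequences of elements of $\lambda$ of length $\kappa$, with the bounded topology, generated by the cones $\mathbf{N}_s=\{x\in{}^{\kappa}\lambda\mid s\subseteq x\}$ for $s\in{}^{<\kappa}\lambda=\bigcup_{\alpha<\kappa}{}^{\alpha}\lambda$. Subsets carry the subspace topology. A space is $\lambda$-Lindelöf if every open cover has a subcover of size strictly less than $\lambda$. **Measures with values in $[0,1]$.** Here $[0,1]$ is regarded as a subset of $[0,\infty]$ with the usual order and addition, and $\sum$ denotes the usual (unordered) sum of non-negative reals, i.e. the supremum of all finite partial sums. A weak $\lambda$-measure space $(X,\mathfrak{M},\mu)$ with $\mu$ taking values in $[0,1]$ consists of a topological space $X$, a family $\mathfrak{M}$ of subsets of $X$ closed under unions of size $<\lambda$ and containing all open subsets of $X$, and a partial function $\mu:\mathscr{P}(X)\to[0,1]$ with $\mathfrak{M}\subseteq\mathrm{dom}(\mu)$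 such that: (M1) $\mu(\emptyset)=0$; (M2) $\mu(X)>0$; (M3) $A\subseteq B$ implies $\mu(A)\leq\mu(B)$ for all $A,B\in\mathfrak{M}$; (M4) for every family $(A_i)_{i<\gamma}$ of pairwise disjoint sets of $\mathfrak{M}$ of length an ordinal $\gamma<\lambda$, $\mu(\bigcup_{i<\gamma}A_i)=\sum_{i<\gamma}\mu(A_i)$; (M5) for every $x\in X$ with $\{x\}\in\mathfrak{M}$ and every open local basis $\{A_i\mid i<\gamma\}$ at $x$ with $\gamma<\lambda$, $\mu(\{x\})=\inf_{i<\gamma}\mu(A_i)$. It is continuous if $\{x\}\in\mathfrak{M}$ and $\mu(\{x\})=0$ for every $x\in X$. *)

theory Defs
  imports "HOL-Analysis.Analysis"
begin

unbundle cardinal_syntax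

text \<open>
  A cardinal is given by a relation \<open>r\<close> with \<open>Card_order r\<close>, and its set of elements is \<open>Field r\<close>.
  The ordinals strictly below \<open>r\<close> are, up to isomorphism, exactly the proper initial segments
  \<open>underS r a\<close> with \<open>a \<in> Field r\<close>; this is how a length \<open>\<gamma> < lam\<close> is expressed throughout.
\<close>

definition kseq :: "'k rel \<Rightarrow> 'l rel \<Rightarrow> ('k \<Rightarrow> 'l) set" where
  "kseq \<kappa> lam = (Field \<kappa> \<rightarrow>\<^sub>E Field lam)"

definition cone_at :: "'k rel \<Rightarrow> 'l rel \<Rightarrow> 'k \<Rightarrow> ('k \<Rightarrow> 'l) \<Rightarrow> ('k \<Rightarrow> 'l) set" where
  "cone_at \<kappa> lam a s = {x \<in> kseq \<kappa> lam. \<forall>i \<in> underS \<kappa> a. x i = s i}"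

definition bounded_topology :: "'k rel \<Rightarrow> 'l rel \<Rightarrow> ('k \<Rightarrow> 'l) topology" where
  "bounded_topology \<kappa> lam =
     topology_generated_by
       {cone_at \<kappa> lam a s | a s. a \<in> Field \<kappa> \<and> s \<in> (underS \<kappa> a \<rightarrow>\<^sub>E Field lam)}"

definition topology_base :: "'a topology \<Rightarrow> 'a set set \<Rightarrow> bool" where
  "topology_base T \<B> \<longleftrightarrow>
     (\<forall>V \<in> \<B>. openin T V) \<and>
     (\<forall>U x. openin T U \<and> x \<in> U \<longrightarrow> (\<exists>V \<in> \<B>. x \<in> V \<and> V \<subseteq> U))"

definition has_weight :: "'a topology \<Rightarrow> 'l rel \<Rightarrow> bool" where
  "has_weight T lam \<longleftrightarrow>
     (\<exists>\<B>. topology_base T \<B> \<and> |\<B>| =o lam) \<and> (\<forall>\<B>. topology_base T \<B> \<longrightarrow> lam \<le>o |\<B>| )"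

definition card_Lindelof :: "'l rel \<Rightarrow> 'a topology \<Rightarrow> bool" where
  "card_Lindelof lam T \<longleftrightarrow>
     (\<forall>\<U>. (\<forall>U \<in> \<U>. openin T U) \<and> \<Union>\<U> = topspace T
        \<longrightarrow> (\<exists>\<V>. |\<V>| <o lam \<and> \<V> \<subseteq> \<U> \<and> \<Union>\<V> = topspace T))"

definition open_local_basis :: "'a topology \<Rightarrow> 'a \<Rightarrow> 'a set set \<Rightarrow> bool" where
  "open_local_basis T x \<A> \<longleftrightarrow>
     (\<forall>A \<in> \<A>. openin T A \<and> x \<in> A) \<and>
     (\<forall>U. openin T U \<and> x \<in> U \<longrightarrow> (\<exists>A \<in> \<A>. A \<subseteq> U))"

text \<open>
  The measure is a partial function on the powerset of the space, whose domain may be larger than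
  the family \<open>M\<close>. Its values are elements of \<open>{0..1}\<close> inside \<open>ennreal\<close>, where every family is
  summable and \<open>infsum\<close> is the supremum of the finite partial sums.
\<close>

definition weak_unit_measure_space ::
  "'l rel \<Rightarrow> 'a topology \<Rightarrow> 'a set set \<Rightarrow> ('a set \<rightharpoonup> ennreal) \<Rightarrow> bool" where
  "weak_unit_measure_space lam T M \<mu> \<longleftrightarrow>
     M \<subseteq> Pow (topspace T) \<and>
     (\<forall>\<A>. \<A> \<subseteq> M \<and> |\<A>| <o lam \<longrightarrow> \<Union>\<A> \<in> M) \<and>
     (\<forall>U. openin T U \<longrightarrow> U \<in> M) \<and>
     dom \<mu> \<subseteq> Pow (topspace T) \<and> M \<subseteq> dom \<mu> \<and> ran \<mu> \<subseteq> {0..1} \<and>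
     the (\<mu> {}) = 0 \<and>
     the (\<mu> (topspace T)) > 0 \<and>
     (\<forall>A \<in> M. \<forall>B \<in> M. A \<subseteq> B \<longrightarrow> the (\<mu> A) \<le> the (\<mu> B)) \<and>
     (\<forall>g \<in> Field lam. \<forall>A. A ` underS lam g \<subseteq> M \<and> disjoint_family_on A (underS lam g) \<longrightarrow>
        the (\<mu> (\<Union>i \<in> underS lam g. A i)) = (\<Sum>\<^sub>\<infinity>i \<in> underS lam g. the (\<mu> (A i)))) \<and>
     (\<forall>x \<in> topspace T. {x} \<in> M \<longrightarrow>
        (\<forall>g \<in> Field lam. \<forall>A. open_local_basis T x (A ` underS lam g) \<longrightarrow>
           the (\<mu> {x}) = (INF i \<in> underS lam g. the (\<mu> (A i)))))"

definition continuous_measure ::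
  "'a topology \<Rightarrow> 'a set set \<Rightarrow> ('a set \<rightharpoonup> ennreal) \<Rightarrow> bool" where
  "continuous_measure T M \<mu> \<longleftrightarrow> (\<forall>x \<in> topspace T. {x} \<in> M \<and> \<mu> {x} = Some 0)"

text \<open>
  Ultrafilters on \<open>S\<close> are rendered as library filters on the ambient type that concentrate on \<open>S\<close>.
\<close>

definition ultrafilter_on :: "'a set \<Rightarrow> 'a filter \<Rightarrow> bool" where
  "ultrafilter_on S F \<longleftrightarrow>
     F \<noteq> bot \<and> F \<le> principal S \<and>
     (\<forall>A \<subseteq> S. (\<forall>\<^sub>F x in F. x \<in> A) \<or> (\<forall>\<^sub>F x in F. x \<in> S - A))"

definition card_complete_filter :: "'l rel \<Rightarrow> 'a filter \<Rightarrow> bool" where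
  "card_complete_filter lam F \<longleftrightarrow>
     (\<forall>\<A>. |\<A>| <o lam \<and> (\<forall>A \<in> \<A>. \<forall>\<^sub>F x in F. x \<in> A) \<longrightarrow> (\<forall>\<^sub>F x in F. x \<in> \<Inter>\<A>))"

definition measurable_cardinal :: "'l rel \<Rightarrow> bool" where
  "measurable_cardinal lam \<longleftrightarrow>
     Card_order lam \<and> natLeq <o lam \<and>
     (\<exists>F. ultrafilter_on (Field lam) F \<and> card_complete_filter lam F \<and>
          (\<forall>x \<in> Field lam. F \<noteq> principal {x}))"

end

theory Submission
  imports Defs "HOL-Library.Countable_Set_Type"
begin

text \<open>
  From a continuous measure \<open>\<mu>\<close> on \<open>X\<close>, call \<open>x\<close> bad if some basic neighbourhood of \<open>x\<close> is null.
  At most countably many cones of each length are positive, so fewer than \<open>\<lambda>\<close> points are not bad: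
  if \<open>\<kappa>\<close> is countable there are at most \<open>2\<^sup>\<aleph>\<^sup>0\<close> of them, and if \<open>\<kappa>\<close> is uncountable, regularity bounds
  the measures of the neighbourhoods of such a point away from \<open>0\<close>, so there are only countably many.
  Hence the set of bad points has positive measure. It is partitioned by the maximal null cones, of
  which there are at most \<open>\<lambda>\<close>, and every union of these is open; so \<open>\<mu>\<close> induces a measure on all
  subsets of \<open>\<lambda>\<close> vanishing at points. If it had no atom, \<open>\<lambda>\<close> would split for every \<open>n\<close> into
  countably many pieces of measure below \<open>1/n\<close>, and thus into at most \<open>2\<^sup>\<aleph>\<^sup>0\<close> null sets, which is
  impossible; an atom yields the ultrafilter.

  Conversely, an open cover without a small subcover yields points \<open>x\<^sub>i\<close> (\<open>i < \<lambda>\<close>) such that each point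
  of \<open>X\<close> has a neighbourhood containing fewer than \<open>\<lambda>\<close> of them. The measure that is \<open>1\<close> on \<open>A\<close> iff
  \<open>x\<^sub>i \<in> A\<close> for almost all \<open>i\<close> with respect to the ultrafilter is then continuous.
\<close>

subsection \<open>Cardinals\<close>

lemma countable_imp_ordLess:
  assumes "natLeq <o r" "countable A"
  shows "|A| <o r"
  using assms(2) ordLeq_ordLess_trans[OF _ assms(1)] by (simp add: countable_card_le_natLeq)

lemma image_ordLess:
  assumes "|A| <o r"
  shows "|f ` A| <o r"
  by (rule ordLeq_ordLess_trans[OF card_of_image assms])

text \<open>Lengths below \<open>lam\<close> are coded as initial segments
  \<open>underS lam g\<close>. This bijection lets (M4) be applied to any set of size below
  \<open>lam\<close>, listed without repetition.\<close>

lemma Card_order_bij_betw_underS: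
  assumes "Card_order r" "|A| <o r"
  obtains g e where "g \<in> Field r" "bij_betw e (underS r g) A"
proof -
  have wo: "Well_order r"
    using assms(1) by (simp add: card_order_on_well_order_on)
  obtain g where g: "g \<in> Field r" "|A| =o Restr r (underS r g)"
    using assms(2) ordLess_iff_ordIso_Restr[OF wo card_of_Well_order] by blast
  have F: "Field (Restr r (underS r g)) = underS r g"
    using wo Field_Restr_ofilter wo_rel.underS_ofilter by (metis wo_rel_def)
  obtain f where "iso |A| (Restr r (underS r g)) f"
    using g(2) unfolding ordIso_def by auto
  then have "bij_betw f A (underS r g)"
    unfolding iso_def F by (simp add: Field_card_of)
  then show thesis
    using that g(1) bij_betw_inv_into by blast
qed

text \<open>A choice function is recovered from its graph. Numbering the index set and every factor
  turns the graph into a set of natural numbers, so the product injects into the subsets of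
  \<open>nat\<close>.\<close>

lemma card_of_PiE_countable:
  assumes "countable I" "\<And>i. i \<in> I \<Longrightarrow> countable (B i)"
  shows "|Pi\<^sub>E I B| \<le>o ctwo ^c natLeq"
proof -
  define h where "h x = (\<lambda>i. prod_encode (to_nat_on I i, to_nat_on (B i) (x i))) ` I" for x
  have "inj_on h (Pi\<^sub>E I B)"
  proof (rule inj_onI)
    fix x y assume x: "x \<in> Pi\<^sub>E I B" and y: "y \<in> Pi\<^sub>E I B" and eq: "h x = h y"
    show "x = y"
    proof (rule PiE_ext[OF x y])
      fix i assume i: "i \<in> I"
      then have "prod_encode (to_nat_on I i, to_nat_on (B i) (x i)) \<in> h y"
        unfolding eq[symmetric] by (auto simp: h_def)
      then obtain j where j: "j \<in> I" "to_nat_on I i = to_nat_on I j"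
        "to_nat_on (B i) (x i) = to_nat_on (B j) (y j)"
        unfolding h_def by auto
      then have "i = j" using i assms(1) by simp
      then show "x i = y i"
        using j i assms(2)[OF i] x y by (auto simp: PiE_iff)
    qed
  qed
  then have "|Pi\<^sub>E I B| \<le>o |Pow (UNIV :: nat set)|"
    by (intro card_of_ordLeqI[of h]) auto
  also have "|Pow (UNIV :: nat set)| =o |Func (UNIV :: nat set) (UNIV :: bool set)|"
    by (rule card_of_Pow_Func)
  also have "|Func (UNIV :: nat set) (UNIV :: bool set)| = ctwo ^c natLeq"
    by (simp add: cexp_def ctwo_def Field_natLeq Field_card_of)
  finally show ?thesis .
qed

lemma regularCard_bounded:
  assumes "Card_order r" "cinfinite r" "regularCard r" "K \<subseteq> Field r" "|K| <o r"
  obtains b where "b \<in> Field r" "K \<subseteq> underS r b"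
proof -
  have lin: "Linear_order r"
    using assms(1) by (simp add: card_order_on_def well_order_on_def)
  have "\<not> cofinal K r"
    using assms not_ordLess_ordIso unfolding regularCard_def by blast
  then obtain c where c: "c \<in> Field r" "\<And>k. k \<in> K \<Longrightarrow> c = k \<or> (c, k) \<notin> r"
    unfolding cofinal_def by blast
  \<comment> \<open>No element of \<open>K\<close> lies strictly above \<open>c\<close>, but
    \<open>c\<close> itself may belong to \<open>K\<close>. An infinite cardinal has no last
    element, so a strict bound is found one step further.\<close>
  obtain b where b: "b \<in> Field r" "c \<noteq> b" "(c, b) \<in> r"
    using infinite_Card_order_limit assms(1,2) c(1) unfolding cinfinite_def by metis
  have "K \<subseteq> underS r b"
  proof
    fix k assume k: "k \<in> K"
    then have "(k, c) \<in> r"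
      using c assms(4) lin
      by (metis (no_types, lifting) linear_order_on_def partial_order_on_def preorder_on_def
          refl_onD subsetD total_on_def)
    then have "(k, b) \<in> r" "k \<noteq> b"
      using b lin by (auto simp: order_on_defs antisym_def dest: transD)
    then show "k \<in> underS r b" by (simp add: underS_def)
  qed
  then show thesis using that b(1) by blast
qed

lemma obtain_minimal:
  assumes "Well_order r" "A \<subseteq> Field r" "A \<noteq> {}"
  obtains a where "a \<in> A" "\<And>b. b \<in> A \<Longrightarrow> (a, b) \<in> r"
proof -
  have "wo_rel r" using assms(1) by (simp add: wo_rel_def)
  then show thesis
    using that[of "wo_rel.minim r A"] assms(2,3) by (simp add: wo_rel.minim_in wo_rel.minim_least)
qed

subsection \<open>Bounded contents with a \<open>\<lambda>\<close>-complete null ideal\<close>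

text \<open>These are the consequences of (M4) that drive the argument: finite additivity, and
  completeness of the null sets along small disjoint families. Disjointness must be kept here,
  because \<open>M\<close> need not be closed under differences and an overlapping family cannot be
  made disjoint inside \<open>M\<close>.\<close>

locale bounded_content =
  fixes lam :: "'l rel" and M :: "'a set set" and m :: "'a set \<Rightarrow> real"
  assumes Card_order_lam: "Card_order lam"
    and uncountable_lam: "natLeq <o lam"
    and Union_closed: "\<And>\<A>. \<lbrakk>\<A> \<subseteq> M; |\<A>| <o lam\<rbrakk> \<Longrightarrow> \<Union>\<A> \<in> M"
    and nonneg: "\<And>A. A \<in> M \<Longrightarrow> 0 \<le> m A"
    and le_one: "\<And>A. A \<in> M \<Longrightarrow> m A \<le> 1"
    and mono: "\<And>A B. \<lbrakk>A \<in> M; B \<in> M; A \<subseteq> B\<rbrakk> \<Longrightarrow> m A \<le> m B"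
    and add: "\<And>A B. \<lbrakk>A \<in> M; B \<in> M; A \<inter> B = {}\<rbrakk> \<Longrightarrow> m (A \<union> B) = m A + m B"
    and null_disjoint_Union:
      "\<And>\<A>. \<lbrakk>\<A> \<subseteq> M; |\<A>| <o lam; disjoint \<A>; \<And>A. A \<in> \<A> \<Longrightarrow> m A = 0\<rbrakk> \<Longrightarrow> m (\<Union>\<A>) = 0"
begin

lemma countable_less: "countable \<A> \<Longrightarrow> |\<A>| <o lam"
  by (rule countable_imp_ordLess[OF uncountable_lam])

lemma empty_null: "m {} = 0"
  using null_disjoint_Union[of "{}"] countable_less[of "{}"] by simp

lemma finite_Union:
  assumes "finite \<A>" "\<A> \<subseteq> M" "disjoint \<A>"
  shows "m (\<Union>\<A>) = (\<Sum>A\<in>\<A>. m A)"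
  using assms
proof (induction \<A>)
  case empty
  then show ?case by (simp add: empty_null)
next
  case (insert A \<A>)
  have "A \<inter> \<Union>\<A> = {}"
    using insert.prems insert.hyps by (auto simp: pairwise_def disjnt_def)
  moreover have "\<Union>\<A> \<in> M"
    using insert by (intro Union_closed countable_less countable_finite) auto
  ultimately show ?case
    using add[of A "\<Union>\<A>"] insert by (simp add: pairwise_insert)
qed

lemma card_large_le:
  fixes \<epsilon> :: real
  assumes "finite \<A>" "\<A> \<subseteq> M" "disjoint \<A>" "\<And>A. A \<in> \<A> \<Longrightarrow> \<epsilon> \<le> m A"
  shows "card \<A> * \<epsilon> \<le> 1"
proof -
  have "card \<A> * \<epsilon> \<le> (\<Sum>A\<in>\<A>. m A)"
    using sum_mono[of \<A> "\<lambda>_. \<epsilon>" m] assms by simp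
  also have "\<dots> = m (\<Union>\<A>)"
    using finite_Union assms by simp
  also have "\<dots> \<le> 1"
    using assms by (intro le_one Union_closed countable_less countable_finite)
  finally show ?thesis .
qed

lemma finite_large:
  assumes "\<A> \<subseteq> M" "disjoint \<A>" "\<epsilon> > 0"
  shows "finite {A \<in> \<A>. \<epsilon> \<le> m A}"
proof (rule ccontr)
  assume inf: "infinite {A \<in> \<A>. \<epsilon> \<le> m A}"
  obtain n :: nat where n: "1 < n * \<epsilon>"
    using reals_Archimedean3[OF assms(3)] by blast
  obtain \<B> where \<B>: "\<B> \<subseteq> {A \<in> \<A>. \<epsilon> \<le> m A}" "finite \<B>" "card \<B> = n"
    using infinite_arbitrarily_large[OF inf] by blast
  then have "card \<B> * \<epsilon> \<le> 1"
    using assms by (intro card_large_le) (auto intro: pairwise_subset[of _ \<A>])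
  then show False using n \<B>(3) by simp
qed

text \<open>A positive value exceeds some \<open>1 / Suc n\<close>, and total mass at most 1 leaves
  room for only finitely many disjoint sets of that size.\<close>

lemma countable_positive:
  assumes "\<A> \<subseteq> M" "disjoint \<A>"
  shows "countable {A \<in> \<A>. 0 < m A}"
proof -
  have "{A \<in> \<A>. 0 < m A} \<subseteq> (\<Union>n. {A \<in> \<A>. 1 / Suc n \<le> m A})"
  proof
    fix A assume "A \<in> {A \<in> \<A>. 0 < m A}"
    moreover from this obtain n where "1 / Suc n < m A" using nat_approx_posE by blast
    ultimately show "A \<in> (\<Union>n. {A \<in> \<A>. 1 / Suc n \<le> m A})" by (auto intro: less_imp_le)
  qed
  moreover have "countable (\<Union>n. {A \<in> \<A>. 1 / Suc n \<le> m A})"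
    using finite_large[OF assms] by (intro countable_UN) (auto intro: countable_finite)
  ultimately show ?thesis using countable_subset by blast
qed

end

section \<open>Contents on a full power set: null ideal, atoms, atomless splitting\<close>

locale power_content = bounded_content lam "Pow S" m
  for lam :: "'l rel" and S :: "'a set" and m :: "'a set \<Rightarrow> real"
begin

lemma null_Union:
  assumes "\<A> \<subseteq> Pow S" "|\<A>| <o lam" "\<And>A. A \<in> \<A> \<Longrightarrow> m A = 0"
  shows "m (\<Union>\<A>) = 0"
proof -
  \<comment> \<open>The relation \<open>|\<A>|\<close> is itself a well-order of \<open>\<A>\<close>, which makes the family disjoint.\<close>
  define B where "B A = A - \<Union>(underS ( |\<A>| ) A)" for A
  have wo: "Well_order |\<A>|" and F: "Field |\<A>| = \<A>"
    by (auto simp: card_of_well_order_on Field_card_of)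
  have tot: "A \<in> underS ( |\<A>| ) A' \<or> A' \<in> underS ( |\<A>| ) A"
    if "A \<in> \<A>" "A' \<in> \<A>" "A \<noteq> A'" for A A'
    using wo that F unfolding order_on_defs total_on_def underS_def by auto
  have "m (\<Union>(B ` \<A>)) = 0"
  proof (rule null_disjoint_Union)
    show "B ` \<A> \<subseteq> Pow S" using assms(1) by (auto simp: B_def)
    show "|B ` \<A>| <o lam" using assms(2) image_ordLess by blast
    show "disjoint (B ` \<A>)"
    proof (rule pairwiseI)
      fix C D assume "C \<in> B ` \<A>" "D \<in> B ` \<A>" "C \<noteq> D"
      then obtain A A' where "A \<in> \<A>" "A' \<in> \<A>" "A \<noteq> A'" "C = B A" "D = B A'" by auto
      then show "disjnt C D" using tot[of A A'] by (auto simp: B_def disjnt_def)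
    qed
    fix C assume "C \<in> B ` \<A>"
    then obtain A where "A \<in> \<A>" "C = B A" by auto
    then have "m C \<le> m A" "C \<in> Pow S" using assms(1) by (auto intro!: mono simp: B_def)
    then show "m C = 0" using assms(3) \<open>A \<in> \<A>\<close> nonneg[of C] by fastforce
  qed
  moreover have "\<Union>(B ` \<A>) = \<Union>\<A>"
  proof (intro equalityI subsetI)
    fix x assume "x \<in> \<Union>\<A>"
    then have "{A \<in> \<A>. x \<in> A} \<noteq> {}" by blast
    \<comment> \<open>The first member of the family that contains \<open>x\<close> loses nothing at
      \<open>x\<close> when the earlier members are removed.\<close>
    then obtain A where A: "A \<in> {A \<in> \<A>. x \<in> A}"
      "\<And>A'. A' \<in> {A \<in> \<A>. x \<in> A} \<Longrightarrow> (A, A') \<in> |\<A>|"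
      using obtain_minimal[OF wo, of "{A \<in> \<A>. x \<in> A}"] F by auto
    have "x \<notin> A'" if "A' \<in> underS ( |\<A>| ) A" for A'
    proof
      assume "x \<in> A'"
      moreover have "A' \<in> \<A>" "A' \<noteq> A" "(A', A) \<in> |\<A>|"
        using that F by (auto simp: underS_def Field_def)
      ultimately show False
        using A(2)[of A'] wo unfolding order_on_defs antisym_def by blast
    qed
    then show "x \<in> \<Union>(B ` \<A>)" using A(1) by (auto simp: B_def)
  qed (auto simp: B_def)
  ultimately show ?thesis by simp
qed

lemma null_subset:
  assumes "B \<subseteq> C" "C \<subseteq> S" "m C = 0"
  shows "m B = 0"
proof -
  have "B \<in> Pow S" "C \<in> Pow S" using assms by auto
  then show ?thesis using mono[of B C] nonneg[of B] assms by linarith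
qed

lemma add_null:
  assumes "A \<subseteq> S" "B \<subseteq> S" "m B = 0"
  shows "m (A \<union> B) = m A"
proof -
  have "m (B - A) = 0"
    by (rule null_subset[of _ B]) (use assms in auto)
  moreover have "m (A \<union> (B - A)) = m A + m (B - A)"
    using assms by (intro add) auto
  ultimately show ?thesis by simp
qed

text \<open>The filter consists of the properties that hold on \<open>A\<close> outside a null set.
  Small unions of null sets are null, which gives completeness; the atom property decides every set;
  and null points rule out a principal filter, since it would make \<open>A\<close> null.\<close>

lemma atom_imp_ultrafilter:
  assumes null: "\<And>x. x \<in> S \<Longrightarrow> m {x} = 0"
    and A: "A \<subseteq> S" "0 < m A"
    and atom: "\<And>B. B \<subseteq> A \<Longrightarrow> m B = 0 \<or> m (A - B) = 0"
  shows "\<exists>F. ultrafilter_on S F \<and> card_complete_filter lam F \<and> (\<forall>x\<in>S. F \<noteq> principal {x})"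
proof -
  define F where "F = Abs_filter (\<lambda>P. m {x \<in> A. \<not> P x} = 0)"
  have Un0: "m (B \<union> C) = 0" if "m B = 0" "m C = 0" "B \<subseteq> A" "C \<subseteq> A" for B C
    using add_null[of B C] that A by auto
  have sub0: "m B = 0" if "m C = 0" "B \<subseteq> C" "C \<subseteq> A" for B C
    using null_subset[of B C] that A by auto
  have ev: "eventually P F \<longleftrightarrow> m {x \<in> A. \<not> P x} = 0" for P
    unfolding F_def
  proof (rule eventually_Abs_filter, unfold_locales)
    show "m {x \<in> A. \<not> True} = 0" by (simp add: empty_null)
  next
    fix P Q assume "m {x \<in> A. \<not> P x} = 0" "m {x \<in> A. \<not> Q x} = 0"
    then have "m ({x \<in> A. \<not> P x} \<union> {x \<in> A. \<not> Q x}) = 0" by (intro Un0) auto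
    then show "m {x \<in> A. \<not> (P x \<and> Q x)} = 0" by (rule sub0) auto
  next
    fix P Q assume "\<forall>x. P x \<longrightarrow> Q x" "m {x \<in> A. \<not> P x} = 0"
    then show "m {x \<in> A. \<not> Q x} = 0" by (elim sub0) auto
  qed
  have "F \<noteq> bot"
    using ev[of "\<lambda>_. False"] A(2) by (auto simp: trivial_limit_def)
  moreover have "F \<le> principal S"
    unfolding le_principal ev using A(1) empty_null
    by (metis (mono_tags, lifting) Collect_empty_eq subsetD)
  moreover have "(\<forall>\<^sub>F x in F. x \<in> B) \<or> (\<forall>\<^sub>F x in F. x \<in> S - B)" for B
  proof -
    have "{x \<in> A. x \<notin> B} = A - B" "{x \<in> A. x \<notin> S - B} = A \<inter> B" using A(1) by auto
    moreover have "A - (A \<inter> B) = A - B" by auto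
    ultimately show ?thesis unfolding ev using atom[of "A \<inter> B"] by auto
  qed
  moreover have "card_complete_filter lam F"
    unfolding card_complete_filter_def
  proof (intro allI impI, elim conjE)
    fix \<A> :: "'a set set"
    assume \<A>: "|\<A>| <o lam" "\<forall>B\<in>\<A>. \<forall>\<^sub>F x in F. x \<in> B"
    have "m (\<Union>((\<lambda>B. {x \<in> A. x \<notin> B}) ` \<A>)) = 0"
      using \<A> A(1) ev by (intro null_Union image_ordLess) auto
    moreover have "\<Union>((\<lambda>B. {x \<in> A. x \<notin> B}) ` \<A>) = {x \<in> A. x \<notin> \<Inter>\<A>}" by auto
    ultimately show "\<forall>\<^sub>F x in F. x \<in> \<Inter>\<A>" unfolding ev by simp
  qed
  moreover have "F \<noteq> principal {x}" if "x \<in> S" for x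
  proof
    assume "F = principal {x}"
    then have "\<forall>\<^sub>F y in F. y = x" by (simp add: eventually_principal)
    then have "m {y \<in> A. y \<noteq> x} = 0" unfolding ev .
    then have "m ({y \<in> A. y \<noteq> x} \<union> {x}) = 0"
      using add_null[of "{y \<in> A. y \<noteq> x}" "{x}"] null[OF that] A(1) that by auto
    moreover have "m A \<le> m ({y \<in> A. y \<noteq> x} \<union> {x})"
      using A(1) that by (intro mono) auto
    ultimately show False using A(2) by simp
  qed
  ultimately show ?thesis unfolding ultrafilter_on_def by blast
qed

text \<open>Repeated halving: of two disjoint positive pieces of a set, one has at most half its
  measure. After \<open>n\<close> rounds a positive piece of measure at most
  \<open>1 / 2 ^ n\<close> remains.\<close>

lemma atomless_small_subset:
  assumes split: "\<And>A. \<lbrakk>A \<subseteq> S; 0 < m A\<rbrakk> \<Longrightarrow> \<exists>B\<subseteq>A. 0 < m B \<and> 0 < m (A - B)"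
    and "A \<subseteq> S" "0 < m A" "0 < \<epsilon>"
  obtains B where "B \<subseteq> A" "0 < m B" "m B < \<epsilon>"
proof -
  have "\<exists>B\<subseteq>A. 0 < m B \<and> m B \<le> 1 / 2 ^ n" for n
  proof (induction n)
    case 0
    then show ?case using assms(2,3) le_one by auto
  next
    case (Suc n)
    then obtain B where B: "B \<subseteq> A" "0 < m B" "m B \<le> 1 / 2 ^ n" by blast
    then obtain C where C: "C \<subseteq> B" "0 < m C" "0 < m (B - C)"
      using split[of B] assms(2) by blast
    have "m (C \<union> (B - C)) = m C + m (B - C)"
      using C B assms(2) by (intro add) auto
    moreover have "C \<union> (B - C) = B" using C by auto
    ultimately have "m C \<le> 1 / 2 ^ Suc n \<or> m (B - C) \<le> 1 / 2 ^ Suc n"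
      using B(3) by (auto simp: field_simps)
    then show ?case using B C by (meson Diff_subset subset_trans)
  qed
  moreover obtain n where "(1 / 2) ^ n < \<epsilon>"
    using real_arch_pow_inv[OF assms(4), of "1/2"] by auto
  ultimately show thesis
    using that by (metis (no_types, lifting) order_le_less_trans power_one_over)
qed

text \<open>Exhaustion by Zorn: a maximal disjoint family of positive sets below
  \<open>\<epsilon>\<close> is countable, and what it leaves over is null, so the remainder can
  serve as one more piece.\<close>

lemma atomless_countable_partition:
  assumes split: "\<And>A. \<lbrakk>A \<subseteq> S; 0 < m A\<rbrakk> \<Longrightarrow> \<exists>B\<subseteq>A. 0 < m B \<and> 0 < m (A - B)"
    and "0 < \<epsilon>"
  obtains \<P> where "countable \<P>" "\<Union>\<P> = S" "\<And>A. A \<in> \<P> \<Longrightarrow> m A < \<epsilon>"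
proof -
  define \<F> where "\<F> = {\<A>. \<A> \<subseteq> Pow S \<and> disjoint \<A> \<and> (\<forall>A\<in>\<A>. 0 < m A \<and> m A < \<epsilon>)}"
  have "\<exists>\<M>\<in>\<F>. \<forall>\<A>\<in>\<F>. \<M> \<subseteq> \<A> \<longrightarrow> \<A> = \<M>"
  proof (rule subset_Zorn')
    fix C assume C: "subset.chain \<F> C"
    then have "C \<subseteq> \<F>" by (simp add: subset_chain_def)
    moreover have "disjoint (\<Union>C)"
    proof (rule pairwise_chain_Union)
      show "\<And>\<A>. \<A> \<in> C \<Longrightarrow> disjoint \<A>"
        using \<open>C \<subseteq> \<F>\<close> unfolding \<F>_def by auto
      show "chain\<^sub>\<subseteq> C"
        using C by (simp add: chain_subset_def subset_chain_def)
    qed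
    ultimately show "\<Union>C \<in> \<F>"
      unfolding \<F>_def by (smt (verit) Sup_le_iff UnionE mem_Collect_eq subsetD)
  qed
  then obtain \<M> where \<M>: "\<M> \<in> \<F>" "\<And>\<A>. \<lbrakk>\<A> \<in> \<F>; \<M> \<subseteq> \<A>\<rbrakk> \<Longrightarrow> \<A> = \<M>" by blast
  define R where "R = S - \<Union>\<M>"
  have "m R = 0"
  proof (rule ccontr)
    assume "m R \<noteq> 0"
    then have "0 < m R" using nonneg[of R] by (auto simp: R_def)
    then obtain B where B: "B \<subseteq> R" "0 < m B" "m B < \<epsilon>"
      using atomless_small_subset[OF split] assms(2) by (metis Diff_subset R_def)
    have "insert B \<M> \<in> \<F>"
      using \<M>(1) B unfolding \<F>_def R_def
      by (auto simp: pairwise_insert disjnt_def)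
    \<comment> \<open>Maximality puts \<open>B\<close> into the family, yet \<open>B\<close> lies in
      the remainder and so misses every member. Hence \<open>B\<close> is empty, contrary to its
      positive measure.\<close>
    then have "B \<in> \<M>" using \<M>(2) by blast
    then have "B = {}" using B(1) by (auto simp: R_def)
    then show False using B(2) empty_null by simp
  qed
  moreover have "\<M> = {A \<in> \<M>. 0 < m A}" using \<M>(1) by (auto simp: \<F>_def)
  then have "countable \<M>" using countable_positive[of \<M>] \<M>(1) by (auto simp: \<F>_def)
  moreover have "\<Union>(insert R \<M>) = S" using \<M>(1) by (auto simp: \<F>_def R_def)
  moreover have "m A < \<epsilon>" if "A \<in> insert R \<M>" for A
    using that \<M>(1) \<open>m R = 0\<close> assms(2) by (auto simp: \<F>_def)
  ultimately show thesis using that[of "insert R \<M>"] by auto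
qed

text \<open>Without atoms there is a countable partition into pieces below \<open>1 / Suc n\<close>
  for every \<open>n\<close>. Choosing one piece from each and intersecting gives null sets that
  cover \<open>S\<close>. There are at most continuum many choices, fewer than \<open>lam\<close>,
  so \<open>S\<close> would be null.\<close>

lemma exists_atom:
  assumes "ctwo ^c natLeq <o lam" and pos: "0 < m S"
  shows "\<exists>A\<subseteq>S. 0 < m A \<and> (\<forall>B\<subseteq>A. m B = 0 \<or> m (A - B) = 0)"
proof (rule ccontr)
  assume no_atom: "\<not> ?thesis"
  have split: "\<exists>B\<subseteq>A. 0 < m B \<and> 0 < m (A - B)" if A: "A \<subseteq> S" "0 < m A" for A
  proof -
    obtain B where "B \<subseteq> A" "m B \<noteq> 0" "m (A - B) \<noteq> 0"
      using A no_atom by blast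
    then show ?thesis
      using nonneg[of B] nonneg[of "A - B"] A by (intro exI[of _ B]) fastforce
  qed
  have "\<exists>\<P>. countable \<P> \<and> \<Union>\<P> = S \<and> (\<forall>A\<in>\<P>. m A < 1 / Suc n)" for n
    using atomless_countable_partition[OF split, of "1 / Suc n"] by (metis of_nat_0_less_iff zero_less_Suc zero_less_divide_1_iff)
  then obtain \<P> where \<P>: "\<And>n. countable (\<P> n)" "\<And>n. \<Union>(\<P> n) = S"
    "\<And>n A. A \<in> \<P> n \<Longrightarrow> m A < 1 / Suc n"
    by metis
  define \<C> where "\<C> = (\<lambda>f. S \<inter> (\<Inter>n. f n)) ` (\<Pi>\<^sub>E n\<in>UNIV. \<P> n)"
  have "m (\<Union>\<C>) = 0"
  proof (rule null_Union)
    show "\<C> \<subseteq> Pow S" by (auto simp: \<C>_def)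
    show "|\<C>| <o lam"
      unfolding \<C>_def using \<P>(1) assms(1)
      by (intro image_ordLess) (auto intro: ordLeq_ordLess_trans card_of_PiE_countable)
    fix C assume "C \<in> \<C>"
    then obtain f where f: "\<And>n. f n \<in> \<P> n" "C = S \<inter> (\<Inter>n. f n)" by (auto simp: \<C>_def)
    have "m C \<le> 1 / Suc n" for n
    proof -
      have "m C \<le> m (f n)" using f \<P>(2) by (intro mono) auto
      then show ?thesis using \<P>(3)[OF f(1)[of n]] by simp
    qed
    then have "m C \<le> 0"
      by (metis nat_approx_posE not_less)
    then show "m C = 0" using nonneg[of C] f(2) by auto
  qed
  moreover have "\<Union>\<C> = S"
  proof (intro equalityI subsetI)
    fix x assume x: "x \<in> S"
    then have "\<forall>n. \<exists>A. A \<in> \<P> n \<and> x \<in> A" using \<P>(2) by blast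
    then obtain f where "\<And>n. f n \<in> \<P> n \<and> x \<in> f n" by metis
    then show "x \<in> \<Union>\<C>" using x by (auto simp: \<C>_def intro!: bexI[of _ f])
  qed (auto simp: \<C>_def)
  ultimately show False using pos by simp
qed

end

text \<open>The content is pushed forward to index sets: \<open>B\<close> receives the measure of
  the union of all parts labelled in \<open>B\<close>. By \<open>sub\<close> arbitrary unions of
  parts lie in \<open>M\<close>, so the result is a content on all subsets of
  \<open>Field lam\<close>, where an atom can be found and turned into an ultrafilter.\<close>

lemma (in bounded_content) null_partition_imp_measurable:
  assumes "ctwo ^c natLeq <o lam"
    and sub: "\<And>\<A>. \<A> \<subseteq> \<D> \<Longrightarrow> \<Union>\<A> \<in> M"
    and "disjoint \<D>" "|\<D>| \<le>o lam"
    and null: "\<And>D. D \<in> \<D> \<Longrightarrow> m D = 0"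
    and "0 < m (\<Union>\<D>)"
  shows "measurable_cardinal lam"
proof -
  have "|\<D>| \<le>o |Field lam|"
    using assms(4) ordLeq_ordIso_trans[OF _ ordIso_symmetric[OF card_of_Field_ordIso[OF Card_order_lam]]]
    by blast
  then obtain h where h: "inj_on h \<D>" "h ` \<D> \<subseteq> Field lam"
    unfolding card_of_ordLeq[symmetric] by blast
  define E where "E B = \<Union>{D \<in> \<D>. h D \<in> B}" for B
  have E_in: "E B \<in> M" for B unfolding E_def by (rule sub) auto
  have E_disj: "E A \<inter> E B = {}" if "A \<inter> B = {}" for A B
  proof (rule ccontr)
    assume "E A \<inter> E B \<noteq> {}"
    then obtain D D' x where D: "D \<in> \<D>" "h D \<in> A" "D' \<in> \<D>" "h D' \<in> B" "x \<in> D" "x \<in> D'"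
      by (auto simp: E_def)
    then have "D = D'" using assms(3) by (auto simp: pairwise_def disjnt_def)
    then show False using D that by auto
  qed
  interpret E: power_content lam "Field lam" "\<lambda>B. m (E B)"
  proof
    show "Card_order lam" "natLeq <o lam" by (fact Card_order_lam uncountable_lam)+
    show "\<And>\<A>. \<A> \<subseteq> Pow (Field lam) \<Longrightarrow> \<Union>\<A> \<in> Pow (Field lam)" by auto
    show "0 \<le> m (E A)" "m (E A) \<le> 1" for A
      using E_in nonneg le_one by auto
    show "m (E A) \<le> m (E B)" if "A \<subseteq> B" for A B
      using that by (intro mono E_in) (auto simp: E_def)
    show "m (E (A \<union> B)) = m (E A) + m (E B)" if "A \<inter> B = {}" for A B
    proof -
      have "E (A \<union> B) = E A \<union> E B" by (auto simp: E_def)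
      then show ?thesis using add[OF E_in E_in E_disj[OF that]] by simp
    qed
    show "m (E (\<Union>\<A>)) = 0"
      if \<A>: "|\<A>| <o lam" "disjoint \<A>" "\<And>A. A \<in> \<A> \<Longrightarrow> m (E A) = 0" for \<A>
    proof -
      have "E (\<Union>\<A>) = \<Union>(E ` \<A>)" by (auto simp: E_def)
      moreover have "m (\<Union>(E ` \<A>)) = 0"
      proof (rule null_disjoint_Union)
        show "disjoint (E ` \<A>)"
          unfolding pairwise_image
        proof (rule pairwiseI, intro impI)
          fix A B assume "A \<in> \<A>" "B \<in> \<A>" "A \<noteq> B"
          then show "disjnt (E A) (E B)"
            using \<A>(2) E_disj[of A B] by (simp add: pairwise_def disjnt_def)
        qed
      qed (use \<A> E_in image_ordLess in auto)
      ultimately show ?thesis by simp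
    qed
  qed
  have pos: "0 < m (E (Field lam))"
  proof -
    have "E (Field lam) = \<Union>\<D>" using h(2) by (auto simp: E_def)
    then show ?thesis using assms(6) by simp
  qed
  \<comment> \<open>The labelling \<open>h\<close> need not be onto: a label carries either a single
    null part or the empty union.\<close>
  have pt: "m (E {x}) = 0" for x
  proof (cases "\<exists>D\<in>\<D>. h D = x")
    case True
    then obtain D where "D \<in> \<D>" "h D = x" by blast
    then have "{D' \<in> \<D>. h D' \<in> {x}} = {D}" using h(1) by (auto dest: inj_onD)
    then show ?thesis using null[OF \<open>D \<in> \<D>\<close>] by (simp add: E_def)
  next
    case False
    then have "E {x} = {}" by (auto simp: E_def)
    then show ?thesis by (simp add: empty_null)
  qed
  show ?thesis
    using E.exists_atom[OF assms(1) pos] E.atom_imp_ultrafilter pt Card_order_lam uncountable_lam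
    unfolding measurable_cardinal_def by metis
qed

subsection \<open>From continuous measures to measurable cardinals\<close>

lemma weak_unit_measure_spaceD:
  assumes "weak_unit_measure_space lam T M \<mu>"
  shows "\<forall>\<A>. \<A> \<subseteq> M \<and> |\<A>| <o lam \<longrightarrow> \<Union>\<A> \<in> M"
    and "\<forall>U. openin T U \<longrightarrow> U \<in> M"
    and "M \<subseteq> dom \<mu>" "ran \<mu> \<subseteq> {0..1}"
    and "the (\<mu> {}) = 0" "0 < the (\<mu> (topspace T))"
    and "\<forall>A\<in>M. \<forall>B\<in>M. A \<subseteq> B \<longrightarrow> the (\<mu> A) \<le> the (\<mu> B)"
    and "\<forall>g\<in>Field lam. \<forall>A. A ` underS lam g \<subseteq> M \<and> disjoint_family_on A (underS lam g) \<longrightarrow>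
        the (\<mu> (\<Union>i\<in>underS lam g. A i)) = (\<Sum>\<^sub>\<infinity>i\<in>underS lam g. the (\<mu> (A i)))"
  using assms unfolding weak_unit_measure_space_def by simp_all

lemma weak_unit_measure_space_le_one:
  assumes "weak_unit_measure_space lam T M \<mu>" "A \<in> M"
  shows "the (\<mu> A) \<le> 1"
proof -
  obtain y where y: "\<mu> A = Some y" using weak_unit_measure_spaceD(3)[OF assms(1)] assms(2) by blast
  then have "y \<in> {0..1}" using weak_unit_measure_spaceD(4)[OF assms(1)] ranI by fast
  then show ?thesis using y by simp
qed

lemma weak_unit_measure_space_Union:
  assumes w: "weak_unit_measure_space lam T M \<mu>" and "Card_order lam"
    and "\<A> \<subseteq> M" "|\<A>| <o lam" "disjoint \<A>"
  shows "the (\<mu> (\<Union>\<A>)) = (\<Sum>\<^sub>\<infinity>A\<in>\<A>. the (\<mu> A))"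
proof -
  obtain g e where g: "g \<in> Field lam" and e: "bij_betw e (underS lam g) \<A>"
    using Card_order_bij_betw_underS[OF assms(2,4)] .
  have e_im: "e ` underS lam g = \<A>" using e by (rule bij_betw_imp_surj_on)
  have "disjoint_family_on e (underS lam g)"
    unfolding disjoint_family_on_def
  proof (intro ballI impI)
    fix i j assume "i \<in> underS lam g" "j \<in> underS lam g" "i \<noteq> j"
    then have "e i \<in> \<A>" "e j \<in> \<A>" "e i \<noteq> e j"
      using e by (auto simp: bij_betw_def dest: inj_onD)
    then show "e i \<inter> e j = {}"
      using assms(5) by (auto simp: pairwise_def disjnt_def)
  qed
  then have "the (\<mu> (\<Union>i\<in>underS lam g. e i)) = (\<Sum>\<^sub>\<infinity>i\<in>underS lam g. the (\<mu> (e i)))"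
    using weak_unit_measure_spaceD(8)[OF w, rule_format, OF g, of e] e_im assms(3) by simp
  then show ?thesis
    unfolding e_im infsum_reindex_bij_betw[OF e, of "\<lambda>A. the (\<mu> A)"] .
qed

lemma weak_unit_measure_space_imp_bounded_content:
  assumes w: "weak_unit_measure_space lam T M \<mu>" and lam: "Card_order lam" "natLeq <o lam"
  shows "bounded_content lam M (\<lambda>A. enn2real (the (\<mu> A)))"
proof
  show "Card_order lam" "natLeq <o lam" by fact+
  have le1: "the (\<mu> A) \<le> 1" if "A \<in> M" for A
    by (rule weak_unit_measure_space_le_one[OF w that])
  then have fin: "the (\<mu> A) < top" if "A \<in> M" for A
    using that ennreal_one_less_top order_le_less_trans by blast
  have "enn2real (the (\<mu> A)) \<le> enn2real 1" if "A \<in> M" for A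
    by (rule enn2real_mono) (use le1[OF that] in auto)
  then show "enn2real (the (\<mu> A)) \<le> 1" if "A \<in> M" for A
    using that by simp
  show "\<Union>\<A> \<in> M" if "\<A> \<subseteq> M" "|\<A>| <o lam" for \<A>
    using weak_unit_measure_spaceD(1)[OF w] that by simp
  show "enn2real (the (\<mu> A)) \<le> enn2real (the (\<mu> B))" if "A \<in> M" "B \<in> M" "A \<subseteq> B" for A B
  proof (rule enn2real_mono)
    show "the (\<mu> A) \<le> the (\<mu> B)"
      using weak_unit_measure_spaceD(7)[OF w] that by simp
  qed (use fin that in auto)
  show "enn2real (the (\<mu> (A \<union> B))) = enn2real (the (\<mu> A)) + enn2real (the (\<mu> B))"
    if "A \<in> M" "B \<in> M" "A \<inter> B = {}" for A B
  \<comment> \<open>If \<open>A = B\<close>, the set \<open>{A, B}\<close> has only one element and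
    its sum would count one term instead of two. Disjointness then forces both sets to be empty, and
    the claim reads 0 = 0 + 0.\<close>
  proof (cases "A = B")
    case True
    then have "A = {}" "B = {}" using that by auto
    moreover have "the (\<mu> {}) = 0" by (rule weak_unit_measure_spaceD(5)[OF w])
    ultimately show ?thesis by simp
  next
    case False
    have "|{A, B}| <o lam"
      by (rule countable_imp_ordLess[OF lam(2)]) auto
    then have "the (\<mu> (\<Union>{A, B})) = (\<Sum>\<^sub>\<infinity>C\<in>{A, B}. the (\<mu> C))"
      using that by (intro weak_unit_measure_space_Union[OF w lam(1)]) (auto simp: pairwise_insert disjnt_def)
    then have "the (\<mu> (A \<union> B)) = the (\<mu> A) + the (\<mu> B)"
      using False by simp
    then show ?thesis using fin that by (simp add: enn2real_plus)
  qed
  show "enn2real (the (\<mu> (\<Union>\<A>))) = 0"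
    if "\<A> \<subseteq> M" "|\<A>| <o lam" "disjoint \<A>" "\<And>A. A \<in> \<A> \<Longrightarrow> enn2real (the (\<mu> A)) = 0" for \<A>
  proof -
    \<comment> \<open>Since \<open>enn2real\<close> also sends infinity to 0, finiteness of the
      measure is needed to get back to the value 0 in \<open>ennreal\<close>.\<close>
    have "the (\<mu> A) = 0" if "A \<in> \<A>" for A
      using fin[of A] that \<open>\<A> \<subseteq> M\<close> \<open>\<And>A. A \<in> \<A> \<Longrightarrow> enn2real (the (\<mu> A)) = 0\<close>[OF that]
      by (auto simp: enn2real_eq_0_iff)
    then have "(\<Sum>\<^sub>\<infinity>A\<in>\<A>. the (\<mu> A)) = 0" by (rule infsum_0)
    then show ?thesis using weak_unit_measure_space_Union[OF w lam(1) that(1-3)] by simp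
  qed
qed simp

text \<open>Cellularity is at most weight: a nonempty basic set chosen inside each member determines
  that member, because the members are disjoint.\<close>

lemma has_weight_disjoint_le:
  assumes "has_weight T lam" "disjoint \<D>" "\<And>D. D \<in> \<D> \<Longrightarrow> openin T D \<and> D \<noteq> {}"
  shows "|\<D>| \<le>o lam"
proof -
  obtain \<B> where \<B>: "topology_base T \<B>" "|\<B>| =o lam"
    using assms(1) unfolding has_weight_def by blast
  have "\<exists>V\<in>\<B>. V \<noteq> {} \<and> V \<subseteq> D" if "D \<in> \<D>" for D
    using \<B>(1) assms(3)[OF that] unfolding topology_base_def by blast
  then obtain f where f: "\<And>D. D \<in> \<D> \<Longrightarrow> f D \<in> \<B> \<and> f D \<noteq> {} \<and> f D \<subseteq> D" by metis
  have "inj_on f \<D>"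
  proof (rule inj_onI)
    fix D D' assume D: "D \<in> \<D>" "D' \<in> \<D>" "f D = f D'"
    then have "\<not> disjnt D D'" using f[of D] f[of D'] by (auto simp: disjnt_def)
    then show "D = D'" using D assms(2) by (auto simp: pairwise_def)
  qed
  then have "|\<D>| \<le>o |\<B>|" using f by (intro card_of_ordLeqI[of f]) auto
  then show ?thesis using \<B>(2) by (rule ordLeq_ordIso_trans)
qed

section \<open>Cones and the partition of the bad points into null cones\<close>

lemma openin_cone_at:
  assumes "x \<in> kseq \<kappa> lam" "a \<in> Field \<kappa>"
  shows "openin (bounded_topology \<kappa> lam) (cone_at \<kappa> lam a x)"
proof -
  \<comment> \<open>The generating cones are indexed by sequences that are \<open>undefined\<close>
    outside \<open>underS \<kappa> a\<close>, so \<open>x\<close> is first cut down to that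
    segment.\<close>
  have "cone_at \<kappa> lam a x = cone_at \<kappa> lam a (restrict x (underS \<kappa> a))"
    by (auto simp: cone_at_def)
  moreover have "restrict x (underS \<kappa> a) \<in> underS \<kappa> a \<rightarrow>\<^sub>E Field lam"
    using assms(1) by (auto simp: kseq_def dest: underS_Field)
  ultimately show ?thesis
    unfolding bounded_topology_def using assms(2) by (intro topology_generated_by_Basis) blast
qed

lemma topspace_subtopology_kseq:
  assumes "X \<subseteq> kseq \<kappa> lam" "Field \<kappa> \<noteq> {}"
  shows "topspace (subtopology (bounded_topology \<kappa> lam) X) = X"
proof -
  obtain a where "a \<in> Field \<kappa>" using assms(2) by blast
  then have "x \<in> topspace (bounded_topology \<kappa> lam)" if "x \<in> X" for x
    using openin_subset[OF openin_cone_at[of x \<kappa> lam a]] that assms(1) by (auto simp: cone_at_def)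
  then show ?thesis by (auto simp: topspace_subtopology)
qed

lemma continuous_measure_imp_measurable:
  fixes \<kappa> :: "'k rel" and lam :: "'l rel"
  assumes \<kappa>: "Card_order \<kappa>" "cinfinite \<kappa>" "regularCard \<kappa>"
    and lam: "Card_order lam" "ctwo ^c natLeq <o lam"
    and X: "X \<subseteq> kseq \<kappa> lam"
    and weight: "has_weight (subtopology (bounded_topology \<kappa> lam) X) lam"
    and weak: "weak_unit_measure_space lam (subtopology (bounded_topology \<kappa> lam) X) M \<mu>"
    and cont: "continuous_measure (subtopology (bounded_topology \<kappa> lam) X) M \<mu>"
  shows "measurable_cardinal lam"
proof -
  define T where "T = subtopology (bounded_topology \<kappa> lam) X"
  define m where "m = (\<lambda>A. enn2real (the (\<mu> A)))"
  define C where "C a x = X \<inter> cone_at \<kappa> lam a x" for a x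
  have "natLeq <o ctwo ^c natLeq"
    using ordLess_ordIso_trans ctwo_Cnotzero
    by (metis natLeq_Card_order ordLess_ctwo_cexp)
  then have unc: "natLeq <o lam"
    using lam(2) ordLess_transitive by blast
  interpret bounded_content lam M m
    unfolding m_def using weak_unit_measure_space_imp_bounded_content[OF weak lam(1) unc] .
  have Field\<kappa>: "Field \<kappa> \<noteq> {}" "infinite (Field \<kappa>)"
    using \<kappa>(2) by (auto simp: cinfinite_def)
  have topT: "topspace T = X"
    unfolding T_def by (rule topspace_subtopology_kseq[OF X Field\<kappa>(1)])
  have open_in: "U \<in> M" if "openin T U" for U
    using weak_unit_measure_spaceD(2)[OF weak] that unfolding T_def by simp
  have wo: "Well_order \<kappa>" using \<kappa>(1) by (simp add: card_order_on_def)
  have openC: "openin T (C a x)" if "x \<in> X" "a \<in> Field \<kappa>" for a x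
    using openin_cone_at[of x \<kappa> lam a] that X unfolding T_def C_def openin_subtopology by blast
  have C_in: "C a x \<in> M" if "x \<in> X" "a \<in> Field \<kappa>" for a x
    using open_in openC that by blast
  have self: "x \<in> C a x" if "x \<in> X" for a x
    using that X by (auto simp: C_def cone_at_def)
  have C_eq: "C a y = C a x" if "y \<in> C a x" for a x y
    using that by (auto simp: C_def cone_at_def)
  have C_anti: "C b x \<subseteq> C a x" if "(a, b) \<in> \<kappa>" for a b x
  proof -
    have "underS \<kappa> a \<subseteq> underS \<kappa> b"
      using that wo by (intro underS_incr) (auto simp: order_on_defs)
    then show ?thesis by (auto simp: C_def cone_at_def)
  qed
  have C_disj: "disjoint (C a ` Z)" for a Z
    using C_eq by (auto simp: pairwise_def disjnt_def) (metis C_eq)+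
  \<comment> \<open>\<open>N\<close> is the set of bad points, those lying in some null cone;
    \<open>P\<close> collects the others.\<close>
  define P where "P = {x \<in> X. \<forall>a\<in>Field \<kappa>. 0 < m (C a x)}"
  define N where "N = X - P"
  have small_null: "Z \<in> M \<and> m Z = 0" if "Z \<subseteq> X" "|Z| <o lam" for Z
  proof -
    have *: "(\<lambda>x. {x}) ` Z \<subseteq> M" "|(\<lambda>x. {x}) ` Z| <o lam"
      using cont that topT image_ordLess unfolding continuous_measure_def T_def[symmetric] by auto
    have "m (\<Union>((\<lambda>x. {x}) ` Z)) = 0"
    proof (rule null_disjoint_Union[OF *])
      show "disjoint ((\<lambda>x. {x}) ` Z)" by (auto simp: pairwise_def)
      show "m A = 0" if "A \<in> (\<lambda>x. {x}) ` Z" for A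
        using that cont topT \<open>Z \<subseteq> X\<close> unfolding continuous_measure_def T_def[symmetric] m_def by auto
    qed
    then show ?thesis using Union_closed[OF *] by simp
  qed
  have P_small: "|P| <o lam"
  proof (cases "countable (Field \<kappa>)")
    case True
    have cnt: "countable (C a ` P)" if "a \<in> Field \<kappa>" for a
    proof -
      have "C a ` P = {A \<in> C a ` P. 0 < m A}" using that by (auto simp: P_def)
      moreover have "countable {A \<in> C a ` P. 0 < m A}"
        using C_in that by (intro countable_positive C_disj) (auto simp: P_def)
      ultimately show ?thesis by simp
    qed
    \<comment> \<open>A point is determined by its branch of cones. On \<open>P\<close> every cone
      is positive and each level offers countably many positive cones, so the branches lie in a
      countable product of countable sets.\<close>
    define f where "f x = (\<lambda>a\<in>Field \<kappa>. C a x)" for x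
    have "inj_on f P"
    proof (rule inj_onI)
      fix x y assume xy: "x \<in> P" "y \<in> P" "f x = f y"
      then have x: "x \<in> X" "x \<in> kseq \<kappa> lam" and y: "y \<in> X" "y \<in> kseq \<kappa> lam"
        using X by (auto simp: P_def)
      show "x = y"
      proof (rule PiE_ext[OF x(2)[unfolded kseq_def] y(2)[unfolded kseq_def]])
        fix i assume i: "i \<in> Field \<kappa>"
        \<comment> \<open>A cone at level \<open>i\<close> fixes only the coordinates strictly below
          \<open>i\<close>; coordinate \<open>i\<close> becomes visible at the later level
          \<open>b\<close>.\<close>
        obtain b where b: "b \<in> Field \<kappa>" "i \<noteq> b" "(i, b) \<in> \<kappa>"
          using infinite_Card_order_limit[OF \<kappa>(1) Field\<kappa>(2) i] by blast
        have "C b x = C b y" using fun_cong[OF xy(3), of b] b(1) by (simp add: f_def)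
        then have "x \<in> C b y" using self[OF x(1), of b] by simp
        then show "x i = y i" using b by (auto simp: C_def cone_at_def underS_def)
      qed
    qed
    then have "|P| \<le>o |\<Pi>\<^sub>E a\<in>Field \<kappa>. C a ` P|"
      by (intro card_of_ordLeqI[of f]) (auto simp: f_def)
    also have "|\<Pi>\<^sub>E a\<in>Field \<kappa>. C a ` P| \<le>o ctwo ^c natLeq"
      by (rule card_of_PiE_countable[OF True cnt])
    also note lam(2)
    finally show ?thesis .
  next
    case False
    have "natLeq \<le>o \<kappa>" using \<kappa>(1,2) by (simp add: natLeq_ordLeq_cinfinite)
    moreover have "\<not> \<kappa> \<le>o natLeq"
    proof
      assume "\<kappa> \<le>o natLeq"
      then have "|Field \<kappa>| \<le>o natLeq"
        using card_of_Field_ordIso[OF \<kappa>(1)] ordIso_ordLeq_trans by blast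
      then show False using False by (simp add: countable_card_le_natLeq)
    qed
    ultimately have \<kappa>_unc: "natLeq <o \<kappa>"
      using natLeq_Well_order wo not_ordLeq_iff_ordLess by blast
    have bound: "\<exists>b\<in>Field \<kappa>. K \<subseteq> underS \<kappa> b" if "countable K" "K \<subseteq> Field \<kappa>" for K
      using regularCard_bounded[OF \<kappa> that(2) countable_imp_ordLess[OF \<kappa>_unc that(1)]] by metis
    define Q where "Q n = {x \<in> X. \<forall>a\<in>Field \<kappa>. 1 / Suc n \<le> m (C a x)}" for n
    \<comment> \<open>A point of \<open>P\<close> outside all \<open>Q n\<close> would have cones
      below \<open>1 / Suc n\<close> at levels \<open>a n\<close>. By regularity these countably
      many levels have a common bound \<open>b\<close>, and the cone at \<open>b\<close> would then
      have measure 0.\<close>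
    have "P \<subseteq> (\<Union>n. Q n)"
    proof (rule ccontr)
      assume "\<not> P \<subseteq> (\<Union>n. Q n)"
      then obtain x where "x \<in> P" "x \<notin> (\<Union>n. Q n)" by blast
      then have x: "x \<in> P" "x \<in> X" "\<And>n. x \<notin> Q n" by (auto simp: P_def)
      then have "\<forall>n. \<exists>a\<in>Field \<kappa>. m (C a x) < 1 / Suc n" by (simp add: Q_def not_le)
      then obtain a where a: "\<And>n. a n \<in> Field \<kappa>" "\<And>n. m (C (a n) x) < 1 / Suc n" by metis
      then obtain b where b: "b \<in> Field \<kappa>" "range a \<subseteq> underS \<kappa> b"
        using bound[of "range a"] by auto
      have "m (C b x) < 1 / Suc n" for n
      proof -
        have "(a n, b) \<in> \<kappa>" using b(2) by (auto simp: underS_def)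
        then have "m (C b x) \<le> m (C (a n) x)"
          using x(2) a(1) b(1) by (intro mono C_in C_anti)
        then show ?thesis using a(2)[of n] by simp
      qed
      moreover have "0 < m (C b x)" using x(1) b(1) by (auto simp: P_def)
      ultimately show False using nat_approx_posE less_asym by metis
    qed
    moreover have "finite (Q n)" for n
    proof (rule ccontr)
      assume "infinite (Q n)"
      \<comment> \<open>Finitely many points are separated at one common level, giving that many
        disjoint cones of measure at least \<open>1 / Suc n\<close>. With \<open>Suc (Suc n)\<close>
        points the total would exceed 1.\<close>
      then obtain R where R: "R \<subseteq> Q n" "finite R" "card R = Suc (Suc n)"
        using infinite_arbitrarily_large by blast
      define d where "d x y = (SOME i. i \<in> Field \<kappa> \<and> x i \<noteq> (y i :: 'l))" for x y
      have d: "d x y \<in> Field \<kappa> \<and> x (d x y) \<noteq> y (d x y)" if "x \<in> R" "y \<in> R" "x \<noteq> y" for x y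
      proof -
        have "x \<in> kseq \<kappa> lam" "y \<in> kseq \<kappa> lam" using that R(1) X by (auto simp: Q_def)
        then have "\<exists>i. i \<in> Field \<kappa> \<and> x i \<noteq> y i"
          using that(3) PiE_ext unfolding kseq_def by metis
        then show ?thesis unfolding d_def by (rule someI_ex)
      qed
      define K where "K = {d x y | x y. x \<in> R \<and> y \<in> R \<and> x \<noteq> y}"
      have "K \<subseteq> (\<lambda>(x, y). d x y) ` (R \<times> R)" by (auto simp: K_def)
      then have "finite K" using R(2) finite_subset by blast
      moreover have "K \<subseteq> Field \<kappa>" using d by (auto simp: K_def)
      ultimately obtain b where b: "b \<in> Field \<kappa>" "K \<subseteq> underS \<kappa> b"
        using bound[of K] by (auto simp: countable_finite)
      have "inj_on (C b) R"
      proof (rule inj_onI, rule ccontr)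
        fix x y assume xy: "x \<in> R" "y \<in> R" "C b x = C b y" "x \<noteq> y"
        then have "x \<in> C b y" using self[of x b] R(1) by (auto simp: Q_def)
        moreover have "d x y \<in> underS \<kappa> b" using xy b(2) by (auto simp: K_def)
        ultimately show False using d[OF xy(1,2,4)] by (auto simp: C_def cone_at_def)
      qed
      then have "card (C b ` R) = Suc (Suc n)" using R(3) by (simp add: card_image)
      moreover have "card (C b ` R) * (1 / Suc n) \<le> 1"
        using R(1,2) C_in b(1) by (intro card_large_le C_disj) (auto simp: Q_def)
      ultimately show False by (simp add: field_simps)
    qed
    ultimately have "countable P"
      by (meson countable_UN countable_finite countable_subset countableI_type)
    then show ?thesis by (rule countable_less)
  qed
  have P: "P \<in> M" "m P = 0"
    using small_null[OF _ P_small] by (auto simp: P_def)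
  \<comment> \<open>The least level of a null cone around a bad point yields the largest null cone
    around it; \<open>\<D>\<close> is the family of these maximal null cones.\<close>
  define level where "level x = wo_rel.minim \<kappa> {a \<in> Field \<kappa>. m (C a x) = 0}" for x
  define \<D> where "\<D> = (\<lambda>x. C (level x) x) ` N"
  have level: "level x \<in> Field \<kappa>" "m (C (level x) x) = 0"
    "\<And>a. \<lbrakk>a \<in> Field \<kappa>; m (C a x) = 0\<rbrakk> \<Longrightarrow> (level x, a) \<in> \<kappa>" if "x \<in> N" for x
  proof -
    obtain a where "a \<in> Field \<kappa>" "\<not> 0 < m (C a x)" "x \<in> X"
      using \<open>x \<in> N\<close> by (auto simp: N_def P_def)
    then have "{a \<in> Field \<kappa>. m (C a x) = 0} \<noteq> {}"
      using nonneg[OF C_in[of x a]] by force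
    then show "level x \<in> Field \<kappa>" "m (C (level x) x) = 0"
      "\<And>a. \<lbrakk>a \<in> Field \<kappa>; m (C a x) = 0\<rbrakk> \<Longrightarrow> (level x, a) \<in> \<kappa>"
      using wo_rel.minim_in[of \<kappa> "{a \<in> Field \<kappa>. m (C a x) = 0}"]
        wo_rel.minim_least[of \<kappa> "{a \<in> Field \<kappa>. m (C a x) = 0}"] wo
      by (auto simp: level_def wo_rel_def)
  qed
  have D_disj: "disjoint \<D>"
  proof (rule pairwiseI)
    \<comment> \<open>Two maximal null cones with a common point agree once both are cut at the
      smaller level. The cone of \<open>y\<close> is then already null at that level, so minimality
      makes the two levels equal.\<close>
    have *: "C (level x) x = C (level y) y"
      if "x \<in> N" "y \<in> N" "z \<in> C (level x) x" "z \<in> C (level y) y" "(level x, level y) \<in> \<kappa>" for x y z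
    proof -
      have "z \<in> C (level x) y" using C_anti that(4,5) by blast
      then have eq: "C (level x) x = C (level x) y" using C_eq that(3) by metis
      then have "(level y, level x) \<in> \<kappa>" using level that(1,2) by metis
      then have "level x = level y"
        using that(5) wo by (auto simp: order_on_defs antisym_def)
      then show ?thesis using eq by simp
    qed
    fix D D' assume D: "D \<in> \<D>" "D' \<in> \<D>" "D \<noteq> D'"
    show "disjnt D D'"
    proof (rule ccontr)
      assume "\<not> disjnt D D'"
      then obtain x y z where xyz: "x \<in> N" "y \<in> N" "D = C (level x) x" "D' = C (level y) y"
        "z \<in> D" "z \<in> D'"
        using D by (auto simp: \<D>_def disjnt_def)
      moreover have "(level x, level y) \<in> \<kappa> \<or> (level y, level x) \<in> \<kappa>"
        using wo level(1) xyz(1,2) wo_rel.TOTALS unfolding wo_rel_def by blast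
      ultimately show False using *[of x y z] *[of y x z] D(3) by auto
    qed
  qed
  have D_open: "openin T D \<and> D \<noteq> {}" if "D \<in> \<D>" for D
    using that openC self level(1) by (fastforce simp: \<D>_def N_def)
  \<comment> \<open>Openness handles families of size \<open>lam\<close>, where closure of
    \<open>M\<close> under unions of size below \<open>lam\<close> would not suffice.\<close>
  have D_Un: "\<Union>\<A> \<in> M" if "\<A> \<subseteq> \<D>" for \<A>
    using that D_open by (intro open_in openin_Union) auto
  have UnD: "\<Union>\<D> = N"
  proof (intro equalityI subsetI)
    fix y assume "y \<in> \<Union>\<D>"
    then obtain x where x: "x \<in> N" "y \<in> C (level x) x" by (auto simp: \<D>_def)
    then have "m (C (level x) y) = 0" using C_eq level(2) by metis
    moreover have "y \<in> X" using x(2) by (simp add: C_def)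
    ultimately show "y \<in> N" using level(1)[OF x(1)] by (force simp: N_def P_def)
  next
    fix x assume "x \<in> N"
    then show "x \<in> \<Union>\<D>" using self[of x "level x"] by (auto simp: \<D>_def N_def)
  qed
  \<comment> \<open>As \<open>P\<close> is null, the bad points carry the whole measure of
    \<open>X\<close>.\<close>
  have "0 < m (\<Union>\<D>)"
  proof -
    have "X \<in> M" using open_in[of X] openin_topspace[of T] topT by simp
    then have "the (\<mu> X) \<le> 1" by (rule weak_unit_measure_space_le_one[OF weak])
    moreover have "the (\<mu> X) > 0"
      using weak_unit_measure_spaceD(6)[OF weak] topT unfolding T_def by simp
    ultimately have "0 < m X"
      unfolding m_def by (metis enn2real_positive_iff ennreal_one_less_top order_le_less_trans)
    moreover have "m (P \<union> N) = m P + m N"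
      using P(1) D_Un[of \<D>] UnD by (intro add) (auto simp: N_def)
    moreover have "P \<union> N = X" by (auto simp: N_def P_def)
    ultimately show ?thesis using P(2) UnD by simp
  qed
  then show ?thesis
    using D_Un D_disj level(2) has_weight_disjoint_le[OF weight D_disj]  D_open
    by (intro null_partition_imp_measurable[OF lam(2), of \<D>]) (auto simp: \<D>_def T_def)
qed

subsection \<open>From measurable cardinals to continuous measures\<close>

lemma under_ordLess:
  assumes "Card_order r" "infinite (Field r)" "a \<in> Field r"
  shows "|under r a| <o r"
proof -
  have wo: "Well_order r" using assms(1) by (simp add: card_order_on_def)
  obtain b where b: "b \<in> Field r" "a \<noteq> b" "(a, b) \<in> r"
    using infinite_Card_order_limit[OF assms] by blast
  then have "under r a \<subseteq> underS r b"
    using wo unfolding under_def underS_def order_on_defs antisym_def by (blast dest: transD)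
  then show ?thesis
    using card_of_underS[OF assms(1) b(1)] card_of_mono1 ordLeq_ordLess_trans by blast
qed

text \<open>The cover is refined to basic sets enumerated along \<open>lam\<close>, and each point
  is given the index of the first one containing it. Without a small subcover \<open>lam\<close>
  many indices occur, and one point is taken for each of \<open>lam\<close> many of them.\<close>

lemma not_card_Lindelof_imp_spread_points:
  assumes lam: "Card_order lam" "infinite (Field lam)"
    and base: "topology_base T \<B>" "|\<B>| \<le>o lam"
    and nL: "\<not> card_Lindelof lam T"
  shows "\<exists>x. (\<forall>i\<in>Field lam. x i \<in> topspace T) \<and>
    (\<forall>y\<in>topspace T. \<exists>U. openin T U \<and> y \<in> U \<and> |{i \<in> Field lam. x i \<in> U}| <o lam)"
proof -
  have wo: "Well_order lam" "wo_rel lam" using lam(1) by (simp_all add: card_order_on_def wo_rel_def)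
  obtain \<U> where \<U>: "\<forall>U\<in>\<U>. openin T U" "\<Union>\<U> = topspace T"
    and no_sub: "\<not> (\<exists>\<V>. |\<V>| <o lam \<and> \<V> \<subseteq> \<U> \<and> \<Union>\<V> = topspace T)"
    using nL unfolding card_Lindelof_def not_all not_imp by (elim exE conjE) (rule that)
  define \<B>' where "\<B>' = {V \<in> \<B>. \<exists>U\<in>\<U>. V \<subseteq> U}"
  have "\<forall>V\<in>\<B>'. \<exists>U. U \<in> \<U> \<and> V \<subseteq> U" by (auto simp: \<B>'_def)
  then obtain u where u: "\<forall>V\<in>\<B>'. u V \<in> \<U> \<and> V \<subseteq> u V"
    by (rule bchoice[THEN exE])
  have "|\<B>'| \<le>o |\<B>|" by (rule card_of_mono1) (auto simp: \<B>'_def)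
  also note base(2)
  also have "lam =o |Field lam|" using lam(1) by (rule ordIso_symmetric[OF card_of_Field_ordIso])
  finally obtain e where e: "inj_on e \<B>'" "e ` \<B>' \<subseteq> Field lam"
    unfolding card_of_ordLeq[symmetric] by blast
  have cover: "\<exists>V\<in>\<B>'. y \<in> V" if y: "y \<in> topspace T" for y
  proof -
    obtain U where "U \<in> \<U>" "y \<in> U" using \<U>(2) y by blast
    moreover obtain V where "V \<in> \<B>" "y \<in> V" "V \<subseteq> U"
      using base(1) bspec[OF \<U>(1) \<open>U \<in> \<U>\<close>] \<open>y \<in> U\<close> unfolding topology_base_def by blast
    ultimately show ?thesis by (auto simp: \<B>'_def)
  qed
  define f where "f y = wo_rel.minim lam (e ` {V \<in> \<B>'. y \<in> V})" for y
  have f_in: "f y \<in> e ` {V \<in> \<B>'. y \<in> V}" if "y \<in> topspace T" for y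
    unfolding f_def using e(2) cover[OF that] by (intro wo_rel.minim_in[OF wo(2)]) auto
  have f_le: "(f y, e V) \<in> lam" if "V \<in> \<B>'" "y \<in> V" for y V
    unfolding f_def using e(2) that by (intro wo_rel.minim_least[OF wo(2)]) auto
  define I where "I = f ` topspace T"
  have I_Field: "I \<subseteq> Field lam" using f_in e(2) by (auto simp: I_def)
  have "\<not> |I| <o lam"
  proof
    assume I: "|I| <o lam"
    \<comment> \<open>Replacing each index that occurs by a cover member above its basic set would
      give a subcover of size below \<open>lam\<close>.\<close>
    define \<V> where "\<V> = (\<lambda>i. u (inv_into \<B>' e i)) ` I"
    have in_V: "y \<in> u (inv_into \<B>' e (f y)) \<and> u (inv_into \<B>' e (f y)) \<in> \<U>" if y: "y \<in> topspace T" for y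
    proof -
      obtain V where "V \<in> \<B>'" "y \<in> V" "f y = e V" using f_in[OF y] by auto
      then show ?thesis using u e(1) by auto
    qed
    have "\<V> \<subseteq> \<U>" using in_V by (auto simp: \<V>_def I_def)
    moreover have "\<Union>\<V> = topspace T"
      using in_V \<U>(2) by (auto simp: \<V>_def I_def)
    moreover have "|\<V>| <o lam" unfolding \<V>_def using I by (rule image_ordLess)
    ultimately have "\<exists>\<V>. |\<V>| <o lam \<and> \<V> \<subseteq> \<U> \<and> \<Union>\<V> = topspace T"
      by (intro exI[of _ \<V>] conjI)
    with no_sub show False by (rule notE)
  qed
  then have "lam \<le>o |I|"
    by (rule iffD1[OF not_ordLess_iff_ordLeq[OF wo(1) card_of_Well_order]])
  then have "|Field lam| \<le>o |I|"
    by (rule ordIso_ordLeq_trans[OF card_of_Field_ordIso[OF lam(1)]])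
  then obtain h where h: "inj_on h (Field lam)" "h ` Field lam \<subseteq> I"
    unfolding card_of_ordLeq[symmetric] by blast
  then have "\<forall>i\<in>Field lam. \<exists>z. z \<in> topspace T \<and> f z = h i" unfolding I_def by force
  then obtain x where x: "\<forall>i\<in>Field lam. x i \<in> topspace T \<and> f (x i) = h i"
    by (rule bchoice[THEN exE])
  have "\<exists>U. openin T U \<and> y \<in> U \<and> |{i \<in> Field lam. x i \<in> U}| <o lam" if y: "y \<in> topspace T" for y
  proof -
    obtain V where V: "V \<in> \<B>'" "y \<in> V" using cover[OF y] by blast
    \<comment> \<open>A point in \<open>V\<close> has first index at most \<open>e V\<close>, and
      the indices \<open>h i\<close> are distinct. So \<open>V\<close> contains \<open>x i\<close>
      for no more \<open>i\<close> than there are elements up to \<open>e V\<close>.\<close>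
    have "h ` {i \<in> Field lam. x i \<in> V} \<subseteq> under lam (e V)"
    proof
      fix j assume "j \<in> h ` {i \<in> Field lam. x i \<in> V}"
      then obtain i where "i \<in> Field lam" "x i \<in> V" "j = h i" by blast
      then show "j \<in> under lam (e V)"
        using bspec[OF x, of i] f_le[OF V(1), of "x i"] by (simp add: under_def)
    qed
    moreover have "inj_on h {i \<in> Field lam. x i \<in> V}" using h(1) by (rule inj_on_subset) auto
    ultimately have "|{i \<in> Field lam. x i \<in> V}| \<le>o |under lam (e V)|"
      by (intro card_of_ordLeqI[of h]) auto
    also have "|under lam (e V)| <o lam" using lam e(2) V(1) by (intro under_ordLess) auto
    finally have "|{i \<in> Field lam. x i \<in> V}| <o lam" .
    moreover have "openin T V" using V(1) base(1) by (auto simp: \<B>'_def topology_base_def)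
    ultimately show ?thesis using V(2) by blast
  qed
  then show ?thesis using x by blast
qed

section \<open>The two-valued measure given by a complete ultrafilter\<close>

lemma card_complete_filter_eventually_ball:
  assumes "card_complete_filter lam F" "|J| <o lam" "\<And>j. j \<in> J \<Longrightarrow> \<forall>\<^sub>F i in F. P j i"
  shows "\<forall>\<^sub>F i in F. \<forall>j\<in>J. P j i"
proof -
  have *: "\<forall>A\<in>(\<lambda>j. {i. P j i}) ` J. \<forall>\<^sub>F i in F. i \<in> A"
    using assms(3) by auto
  have "\<forall>\<^sub>F i in F. i \<in> \<Inter>((\<lambda>j. {i. P j i}) ` J)"
    by (rule mp[OF spec[OF assms(1)[unfolded card_complete_filter_def]] conjI[OF image_ordLess[OF assms(2)] *]])
  then show ?thesis by simp
qed

lemma small_set_notin_filter: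
  assumes F: "ultrafilter_on S F" "card_complete_filter lam F" "\<And>x. x \<in> S \<Longrightarrow> F \<noteq> principal {x}"
    and B: "B \<subseteq> S" "|B| <o lam"
  shows "\<forall>\<^sub>F x in F. x \<notin> B"
proof -
  have pt: "\<forall>\<^sub>F x in F. x \<in> - {b}" if "b \<in> B" for b
  proof (rule ccontr)
    assume *: "\<not> ?thesis"
    have "(\<forall>\<^sub>F x in F. x \<in> {b}) \<or> (\<forall>\<^sub>F x in F. x \<in> S - {b})"
      using F(1) B(1) that unfolding ultrafilter_on_def by blast
    moreover have "\<not> (\<forall>\<^sub>F x in F. x \<in> S - {b})"
    proof
      assume "\<forall>\<^sub>F x in F. x \<in> S - {b}"
      then have "\<forall>\<^sub>F x in F. x \<in> - {b}" by (rule eventually_mono) auto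
      with * show False by blast
    qed
    ultimately have ev: "\<forall>\<^sub>F x in F. x \<in> {b}" by blast
    have "F = principal {b}"
    proof (rule antisym)
      show "F \<le> principal {b}" using ev by (simp add: le_principal)
      show "principal {b} \<le> F"
      proof (rule filter_leI)
        fix P assume "eventually P F"
        \<comment> \<open>The statement \<open>P b\<close> no longer depends on \<open>x\<close>;
          since \<open>F\<close> is proper, holding eventually means that it holds.\<close>
        then have "\<forall>\<^sub>F x in F. P b"
          using ev by eventually_elim simp
        then show "eventually P (principal {b})"
          using F(1) by (simp add: eventually_principal ultrafilter_on_def eventually_const)
      qed
    qed
    then show False using F(3) that B(1) by blast
  qed
  have "\<forall>\<^sub>F x in F. \<forall>b\<in>B. x \<in> - {b}"
    by (rule card_complete_filter_eventually_ball[OF F(2) B(2) pt])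
  then show ?thesis by (rule eventually_mono) auto
qed

text \<open>The measure is the image of the ultrafilter under \<open>x\<close>. For (M4),
  completeness finds a summand of value 1 whenever the union has value 1, and disjointness makes it
  unique. The spreading hypothesis gives every point a null neighbourhood, since the ultrafilter
  contains no small set.\<close>

lemma ultrafilter_measure:
  fixes x :: "'l \<Rightarrow> 'a"
  assumes lam: "Card_order lam" "infinite (Field lam)"
    and F: "ultrafilter_on (Field lam) F" "card_complete_filter lam F"
      "\<And>i. i \<in> Field lam \<Longrightarrow> F \<noteq> principal {i}"
    and x_in: "\<And>i. i \<in> Field lam \<Longrightarrow> x i \<in> topspace T"
    and spread: "\<And>y. y \<in> topspace T \<Longrightarrow>
      \<exists>U. openin T U \<and> y \<in> U \<and> |{i \<in> Field lam. x i \<in> U}| <o lam"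
  shows "\<exists>\<mu>. weak_unit_measure_space lam T (Pow (topspace T)) \<mu> \<and>
    continuous_measure T (Pow (topspace T)) \<mu>"
proof -
  define L where "L A \<longleftrightarrow> (\<forall>\<^sub>F i in F. x i \<in> A)" for A
  define \<mu> where "\<mu> A = (if A \<subseteq> topspace T then Some (if L A then 1 else 0 :: ennreal) else None)" for A
  have \<mu>: "the (\<mu> A) = (if L A then 1 else 0)" if "A \<subseteq> topspace T" for A
    using that by (simp add: \<mu>_def)
  have Fbot: "F \<noteq> bot" and FF: "\<forall>\<^sub>F i in F. i \<in> Field lam"
    using F(1) by (simp_all add: ultrafilter_on_def le_principal)
  have L_mono: "L B" if "L A" "A \<subseteq> B" for A B
    using that(1) unfolding L_def by (rule eventually_mono) (use that(2) in blast)
  have L_top: "L (topspace T)"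
    unfolding L_def using FF by (rule eventually_mono) (rule x_in)
  have L_empty: "\<not> L {}" using Fbot by (simp add: L_def)
  have L_disj: "\<not> (L A \<and> L B)" if "A \<inter> B = {}" for A B
  proof
    assume "L A \<and> L B"
    then have "\<forall>\<^sub>F i in F. x i \<in> A \<and> x i \<in> B" by (simp add: L_def eventually_conj)
    then have "\<forall>\<^sub>F i in F. False" by (rule eventually_mono) (use that in auto)
    then show False using Fbot by simp
  qed
  have ultra: "(\<forall>\<^sub>F i in F. i \<in> B) \<or> (\<forall>\<^sub>F i in F. i \<in> Field lam - B)"
    if "B \<subseteq> Field lam" for B
    using F(1) that by (simp add: ultrafilter_on_def)
  have notL: "\<forall>\<^sub>F i in F. i \<in> {i. x i \<notin> A}" if "\<not> L A" for A
  proof -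
    have "(\<forall>\<^sub>F i in F. i \<in> {i \<in> Field lam. x i \<in> A}) \<or>
        (\<forall>\<^sub>F i in F. i \<in> Field lam - {i \<in> Field lam. x i \<in> A})"
      by (rule ultra) auto
    moreover have "\<not> (\<forall>\<^sub>F i in F. i \<in> {i \<in> Field lam. x i \<in> A})"
    proof
      assume "\<forall>\<^sub>F i in F. i \<in> {i \<in> Field lam. x i \<in> A}"
      then have "L A" unfolding L_def by (rule eventually_mono) simp
      with that show False by simp
    qed
    ultimately have "\<forall>\<^sub>F i in F. i \<in> Field lam - {i \<in> Field lam. x i \<in> A}" by simp
    then show ?thesis by (rule eventually_mono) simp
  qed
  have L_Un: "\<exists>i\<in>J. L (A i)" if "L (\<Union>i\<in>J. A i)" "|J| <o lam" for A and J :: "'l set"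
  proof (rule ccontr)
    assume "\<not> ?thesis"
    then have "\<And>j. j \<in> J \<Longrightarrow> \<forall>\<^sub>F i in F. x i \<notin> A j" using notL by simp
    then have "\<forall>\<^sub>F i in F. \<forall>j\<in>J. x i \<notin> A j"
      by (rule card_complete_filter_eventually_ball[OF F(2) that(2)])
    moreover have "\<forall>\<^sub>F i in F. x i \<in> (\<Union>i\<in>J. A i)" using that(1) by (simp add: L_def)
    ultimately have "\<forall>\<^sub>F i in F. False" by eventually_elim auto
    then show False using Fbot by simp
  qed
  have null_nbhd: "\<exists>U. openin T U \<and> y \<in> U \<and> \<not> L U" if "y \<in> topspace T" for y
  proof -
    obtain U where U: "openin T U" "y \<in> U" "|{i \<in> Field lam. x i \<in> U}| <o lam"
      using spread[OF \<open>y \<in> topspace T\<close>] by (elim exE conjE) (rule that)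
    have "\<forall>\<^sub>F i in F. i \<notin> {i \<in> Field lam. x i \<in> U}"
      using U(3) by (intro small_set_notin_filter[OF F]) auto
    with FF have "\<forall>\<^sub>F i in F. x i \<in> - U" by eventually_elim auto
    then have "L (- U)" by (simp add: L_def)
    then show ?thesis using U L_disj[of U "- U"] by blast
  qed
  have L_single: "\<not> L {y}" if "y \<in> topspace T" for y
    using null_nbhd[OF that] L_mono[of "{y}"] by blast
  have additive: "the (\<mu> (\<Union>i\<in>underS lam g. A i)) = (\<Sum>\<^sub>\<infinity>i\<in>underS lam g. the (\<mu> (A i)))"
    if g: "g \<in> Field lam" and A: "A ` underS lam g \<subseteq> Pow (topspace T)"
      "disjoint_family_on A (underS lam g)" for g A
  proof -
    have sub: "A i \<subseteq> topspace T" if "i \<in> underS lam g" for i using A(1) that by blast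
    then have Un: "(\<Union>i\<in>underS lam g. A i) \<subseteq> topspace T" by blast
    show ?thesis
    proof (cases "L (\<Union>i\<in>underS lam g. A i)")
      case True
      then obtain j where j: "j \<in> underS lam g" "L (A j)"
        using L_Un[OF True card_of_underS[OF lam(1) g]] by blast
      have "\<not> L (A i)" if "i \<in> underS lam g" "i \<noteq> j" for i
        using L_disj[of "A i" "A j"] j A(2) that unfolding disjoint_family_on_def by blast
      then have "(\<Sum>\<^sub>\<infinity>i\<in>underS lam g. the (\<mu> (A i))) = (\<Sum>\<^sub>\<infinity>i\<in>{j}. the (\<mu> (A i)))"
        using j(1) sub \<mu> by (intro infsum_cong_neutral) auto
      then show ?thesis using j True Un sub by (simp add: \<mu>)
    next
      case False
      have "\<not> L (A i)" if "i \<in> underS lam g" for i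
        using False L_mono[of "A i"] that by blast
      then have "(\<Sum>\<^sub>\<infinity>i\<in>underS lam g. the (\<mu> (A i))) = 0"
        using sub \<mu> by (intro infsum_0) auto
      then show ?thesis using False Un by (simp add: \<mu>)
    qed
  qed
  have local_basis: "the (\<mu> {y}) = (INF i\<in>underS lam g. the (\<mu> (A i)))"
    if y: "y \<in> topspace T" and A: "open_local_basis T y (A ` underS lam g)" for y g A
  proof -
    \<comment> \<open>A member of the local basis inside the null neighbourhood is itself null, so
      the infimum is 0, which is also the value at the point.\<close>
    obtain U where "openin T U" "y \<in> U" "\<not> L U" using null_nbhd[OF y] by blast
    have A_open: "\<forall>B\<in>A ` underS lam g. openin T B \<and> y \<in> B"
      using A unfolding open_local_basis_def by (rule conjunct1)
    have A_basis: "\<forall>U. openin T U \<and> y \<in> U \<longrightarrow> (\<exists>B\<in>A ` underS lam g. B \<subseteq> U)"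
      using A unfolding open_local_basis_def by (rule conjunct2)
    have "\<exists>B\<in>A ` underS lam g. B \<subseteq> U"
      by (rule mp[OF spec[OF A_basis] conjI[OF \<open>openin T U\<close> \<open>y \<in> U\<close>]])
    then obtain i where i: "i \<in> underS lam g" "A i \<subseteq> U" "openin T (A i)"
      using A_open by auto
    then have "\<not> L (A i)" using \<open>\<not> L U\<close> L_mono by blast
    then have "the (\<mu> (A i)) = 0" using openin_subset[OF i(3)] by (simp add: \<mu>)
    then have "(INF i\<in>underS lam g. the (\<mu> (A i))) \<le> 0"
      using i(1) by (intro INF_lower2) auto
    then show ?thesis using L_single[OF y] y by (simp add: \<mu>)
  qed
  have "weak_unit_measure_space lam T (Pow (topspace T)) \<mu>"
    unfolding weak_unit_measure_space_def
  proof (intro conjI)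
    show "\<forall>\<A>. \<A> \<subseteq> Pow (topspace T) \<and> |\<A>| <o lam \<longrightarrow> \<Union>\<A> \<in> Pow (topspace T)" by blast
    show "\<forall>U. openin T U \<longrightarrow> U \<in> Pow (topspace T)" using openin_subset by blast
    show "dom \<mu> \<subseteq> Pow (topspace T)" "Pow (topspace T) \<subseteq> dom \<mu>" "ran \<mu> \<subseteq> {0..1}"
      by (auto simp: \<mu>_def ran_def split: if_splits)
    show "the (\<mu> {}) = 0" "0 < the (\<mu> (topspace T))"
      using L_empty L_top by (simp_all add: \<mu>)
    show "\<forall>A\<in>Pow (topspace T). \<forall>B\<in>Pow (topspace T). A \<subseteq> B \<longrightarrow> the (\<mu> A) \<le> the (\<mu> B)"
      using L_mono by (auto simp: \<mu>)
  qed (use additive local_basis in blast)+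
  moreover have "continuous_measure T (Pow (topspace T)) \<mu>"
    unfolding continuous_measure_def using L_single by (simp add: \<mu>_def)
  ultimately show ?thesis by blast
qed

text \<open>This supplies a space to which (2) applies, so that (2) implies (1). The constant
  sequences form a discrete subspace of size \<open>lam\<close>: one coordinate tells them apart, so
  a cone long enough to see it isolates each of them.\<close>

lemma exists_discrete_kseq_space:
  fixes \<kappa> :: "'k rel" and lam :: "'l rel"
  assumes \<kappa>: "Card_order \<kappa>" "cinfinite \<kappa>" and lam: "Card_order lam"
  obtains X where "X \<subseteq> kseq \<kappa> lam"
    "has_weight (subtopology (bounded_topology \<kappa> lam) X) lam"
    "\<not> card_Lindelof lam (subtopology (bounded_topology \<kappa> lam) X)"
proof -
  define c where "c i = (\<lambda>_\<in>Field \<kappa>. i)" for i :: 'l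
  define X where "X = c ` Field lam"
  define T where "T = subtopology (bounded_topology \<kappa> lam) X"
  have Field\<kappa>: "Field \<kappa> \<noteq> {}" "infinite (Field \<kappa>)" using \<kappa>(2) by (auto simp: cinfinite_def)
  then obtain a where a: "a \<in> Field \<kappa>" by blast
  obtain b where b: "b \<in> Field \<kappa>" "a \<in> underS \<kappa> b"
    using infinite_Card_order_limit[OF \<kappa>(1) Field\<kappa>(2) a] by (auto simp: underS_def)
  have X: "X \<subseteq> kseq \<kappa> lam" by (auto simp: X_def c_def kseq_def)
  have inj: "inj_on c (Field lam)"
    using a by (auto simp: inj_on_def c_def dest: fun_cong[of _ _ a])
  have topT: "topspace T = X"
    unfolding T_def by (rule topspace_subtopology_kseq[OF X Field\<kappa>(1)])
  have single: "openin T {y}" if y: "y \<in> X" for y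
  proof -
    have "X \<inter> cone_at \<kappa> lam b y = {y}"
      using y X b a by (auto simp: X_def c_def cone_at_def dest!: bspec[of _ _ a])
    moreover have "openin (bounded_topology \<kappa> lam) (cone_at \<kappa> lam b y)"
      using y X b by (intro openin_cone_at) auto
    ultimately show ?thesis unfolding T_def openin_subtopology by blast
  qed
  have "|X| =o |Field lam|"
    unfolding X_def using inj by (metis bij_betw_imageI card_of_ordIsoI ordIso_symmetric)
  also have "|Field lam| =o lam" using lam by (rule card_of_Field_ordIso)
  finally have card_X: "|X| =o lam" .
  have "|(\<lambda>y. {y}) ` X| =o |X|"
    by (metis bij_betw_imageI card_of_ordIsoI inj_on_def ordIso_symmetric singleton_inject)
  then have card_S: "|(\<lambda>y. {y}) ` X| =o lam" using card_X by (rule ordIso_transitive)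
  have "has_weight T lam"
    unfolding has_weight_def
  proof (intro conjI exI allI impI)
    show "topology_base T ((\<lambda>y. {y}) ` X)"
      unfolding topology_base_def using single openin_subset[of T] topT by fastforce
    show "|(\<lambda>y. {y}) ` X| =o lam" by fact
    fix \<B> assume \<B>: "topology_base T \<B>"
    \<comment> \<open>In a discrete space every base contains all singletons, which bounds the
      weight from below.\<close>
    have "(\<lambda>y. {y}) ` X \<subseteq> \<B>"
    proof
      fix S assume "S \<in> (\<lambda>y. {y}) ` X"
      then obtain y where y: "y \<in> X" "S = {y}" by blast
      then obtain V where "V \<in> \<B>" "y \<in> V" "V \<subseteq> {y}"
        using \<B> single unfolding topology_base_def by blast
      then show "S \<in> \<B>" using y by (metis subset_singletonD empty_iff)
    qed
    then have "|(\<lambda>y. {y}) ` X| \<le>o |\<B>|" by (rule card_of_mono1)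
    then show "lam \<le>o |\<B>|" using card_S ordIso_ordLeq_trans ordIso_symmetric by blast
  qed
  moreover have "\<not> card_Lindelof lam T"
  proof
    assume L: "card_Lindelof lam T"
    have "(\<forall>U\<in>(\<lambda>y. {y}) ` X. openin T U) \<and> \<Union>((\<lambda>y. {y}) ` X) = topspace T"
      using single topT by auto
    then have "\<exists>\<V>. |\<V>| <o lam \<and> \<V> \<subseteq> (\<lambda>y. {y}) ` X \<and> \<Union>\<V> = topspace T"
      by (rule mp[OF spec[OF L[unfolded card_Lindelof_def]]])
    then obtain \<V> where \<V>: "|\<V>| <o lam" "\<V> \<subseteq> (\<lambda>y. {y}) ` X" "\<Union>\<V> = X"
      unfolding topT by blast
    then have "(\<lambda>y. {y}) ` X \<subseteq> \<V>" by auto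
    then have "\<V> = (\<lambda>y. {y}) ` X" using \<V>(2) by blast
    then show False using \<V>(1) card_S not_ordLess_ordIso by blast
  qed
  ultimately show thesis using that X unfolding T_def by blast
qed

theorem corollary7p3:
  fixes \<kappa> :: "'k rel" and lam :: "'l rel"
  assumes "Card_order \<kappa>" and "cinfinite \<kappa>" and "regularCard \<kappa>"
    and "Card_order lam" and "cinfinite lam"
    and "\<kappa> \<le>o lam"
    and "ctwo ^c natLeq <o lam"
  shows
    "((\<exists>X M \<mu>. X \<subseteq> kseq \<kappa> lam \<and>
         has_weight (subtopology (bounded_topology \<kappa> lam) X) lam \<and>
         weak_unit_measure_space lam (subtopology (bounded_topology \<kappa> lam) X) M \<mu> \<and>
         continuous_measure (subtopology (bounded_topology \<kappa> lam) X) M \<mu>)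
      \<longleftrightarrow> measurable_cardinal lam)
     \<and>
     ((\<forall>X. X \<subseteq> kseq \<kappa> lam \<and>
         has_weight (subtopology (bounded_topology \<kappa> lam) X) lam \<and>
         \<not> card_Lindelof lam (subtopology (bounded_topology \<kappa> lam) X) \<longrightarrow>
         (\<exists>\<mu>. weak_unit_measure_space lam (subtopology (bounded_topology \<kappa> lam) X) (Pow X) \<mu> \<and>
              continuous_measure (subtopology (bounded_topology \<kappa> lam) X) (Pow X) \<mu>))
      \<longleftrightarrow> measurable_cardinal lam)"
    (is "(?exists \<longleftrightarrow> _) \<and> (?all \<longleftrightarrow> _)")
proof -
  \<comment> \<open>Both equivalences follow from the cycle (1) to (3), (3) to (2), (2) to
    (1).\<close>
  have "measurable_cardinal lam" if ?exists
    using that continuous_measure_imp_measurable[OF assms(1-4,7)] by blast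
  moreover have ?exists if all: ?all
  proof -
    obtain X where X: "X \<subseteq> kseq \<kappa> lam"
      "has_weight (subtopology (bounded_topology \<kappa> lam) X) lam"
      "\<not> card_Lindelof lam (subtopology (bounded_topology \<kappa> lam) X)"
      using exists_discrete_kseq_space[OF assms(1,2,4)] .
    then show ?thesis using all[rule_format, of X] by blast
  qed
  moreover have ?all if "measurable_cardinal lam"
  proof (intro allI impI, elim conjE)
    fix X
    assume X: "X \<subseteq> kseq \<kappa> lam"
      and weight: "has_weight (subtopology (bounded_topology \<kappa> lam) X) lam"
      and nL: "\<not> card_Lindelof lam (subtopology (bounded_topology \<kappa> lam) X)"
    let ?T = "subtopology (bounded_topology \<kappa> lam) X"
    have inf: "infinite (Field lam)" using assms(5) by (simp add: cinfinite_def)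
    have topT: "topspace ?T = X"
      using X assms(2) by (intro topspace_subtopology_kseq) (auto simp: cinfinite_def)
    obtain \<B> where \<B>: "topology_base ?T \<B>" "|\<B>| \<le>o lam"
      using weight ordIso_imp_ordLeq unfolding has_weight_def by blast
    obtain x where x: "\<forall>i\<in>Field lam. x i \<in> topspace ?T"
      "\<forall>y\<in>topspace ?T. \<exists>U. openin ?T U \<and> y \<in> U \<and> |{i \<in> Field lam. x i \<in> U}| <o lam"
      using not_card_Lindelof_imp_spread_points[OF assms(4) inf \<B> nL] by blast
    obtain F where F: "ultrafilter_on (Field lam) F" "card_complete_filter lam F"
      "\<And>i. i \<in> Field lam \<Longrightarrow> F \<noteq> principal {i}"
      using \<open>measurable_cardinal lam\<close> unfolding measurable_cardinal_def by blast
    show "\<exists>\<mu>. weak_unit_measure_space lam ?T (Pow X) \<mu> \<and> continuous_measure ?T (Pow X) \<mu>"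
      using ultrafilter_measure[OF assms(4) inf F bspec[OF x(1)] bspec[OF x(2)]] unfolding topT .
  qed
  ultimately show ?thesis by blast
qed

end
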